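(* Let $\mathcal{A}$ be a unital $C^*$-algebra, let $a\in\mathcal{A}$ be a positive and invertible element and let $x,y\in\mathcal{A}$. Then: 1) $x\|_{v_a}y$ if and only if there are $\varphi\in\mathcal{S}_a(\mathcal{A})$ and $\mu\in\mathbb{T}$ such that $$\overline{\varphi(ax)}\,\varphi(ay)=\overline{\mu}\,v_a(x)\,v_a(y).$$ 2) $x\|_a y$ if and only if there are $\varphi\in\mathcal{S}_a(\mathcal{A})$ and $\mu\in\mathbb{T}$ such that $$\varphi(x^*ax)=\|x\|_a^2,\quad \varphi(y^*ay)=\|y\|_a^2\quad\text{and}\quad \varphi(x^*ay)=\overline{\mu}\,\|x\|_a\,\|y\|_a.$$
   Context: $\mathbb{T}=\{z\in\mathbb{C} : |z|=1\}$. $\mathcal{S}_a(\mathcal{A})=\{\varphi\in\mathcal{A}' : \varphi\ge 0,\ \varphi(a)=1\}$, where $\mathcal{A}'$ is the topological dual of $\mathcal{A}$. For $x\in\mathcal{A}$, $\|x\|_a=\sup\{\sqrt{\varphi(x^*ax)} : \varphi\in\mathcal{S}_a(\mathcal{A})\}$ and $v_a(x)=\sup\{|\varphi(ax)| : \varphi\in\mathcal{S}_a(\mathcal{A})\}$. One writes $x\|_a y$ ($a$-norm parallelism) if there is $\mu\in\mathbb{T}$ with $\|x+\mu y\|_a=\|x\|_a+\|y\|_a$, and $x\|_{v_a}y$ ($a$-numerical radius parallelism) if there is $\mu\in\mathbb{T}$ with $v_a(x+\mu y)=v_a(x)+v_a(y)$. *)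

theory Defs
  imports "HOL-Analysis.Analysis"
begin

text \<open>Unital C*-algebras over the complex numbers. The superclass
  \<^class>\<open>real_normed_algebra_1\<close> supplies submultiplicativity of the norm and \<open>norm 1 = 1\<close>;
  in particular the zero algebra is excluded.\<close>

class unital_cstar_algebra = real_normed_algebra_1 + banach +
  fixes scaleC :: "complex \<Rightarrow> 'a \<Rightarrow> 'a" (infixr "*\<^sub>C" 75)
    and star :: "'a \<Rightarrow> 'a"
  assumes scaleC_of_real: "of_real r *\<^sub>C x = r *\<^sub>R x"
    and scaleC_add_right: "c *\<^sub>C (x + y) = c *\<^sub>C x + c *\<^sub>C y"
    and scaleC_add_left: "(c + d) *\<^sub>C x = c *\<^sub>C x + d *\<^sub>C x"
    and scaleC_scaleC: "c *\<^sub>C d *\<^sub>C x = (c * d) *\<^sub>C x"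
    and mult_scaleC_left: "(c *\<^sub>C x) * y = c *\<^sub>C (x * y)"
    and mult_scaleC_right: "x * (c *\<^sub>C y) = c *\<^sub>C (x * y)"
    and norm_scaleC: "norm (c *\<^sub>C x) = cmod c * norm x"
    and star_star: "star (star x) = x"
    and star_add: "star (x + y) = star x + star y"
    and star_scaleC: "star (c *\<^sub>C x) = cnj c *\<^sub>C star x"
    and star_mult: "star (x * y) = star y * star x"
    and cstar_identity: "norm (star x * x) = (norm x)\<^sup>2"

definition invertible_elem :: "'a::monoid_mult \<Rightarrow> bool" where
  "invertible_elem a \<longleftrightarrow> (\<exists>b. a * b = 1 \<and> b * a = 1)"

definition spectrum :: "'a::unital_cstar_algebra \<Rightarrow> complex set" where
  "spectrum a = {z. \<not> invertible_elem (a - z *\<^sub>C 1)}"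

definition positive_elem :: "'a::unital_cstar_algebra \<Rightarrow> bool" where
  "positive_elem a \<longleftrightarrow> star a = a \<and> spectrum a \<subseteq> \<real>\<^sub>\<ge>\<^sub>0"

definition topological_dual :: "('a::unital_cstar_algebra \<Rightarrow> complex) set" where
  "topological_dual =
    {\<phi>. (\<forall>x y. \<phi> (x + y) = \<phi> x + \<phi> y) \<and> (\<forall>c x. \<phi> (c *\<^sub>C x) = c * \<phi> x)
       \<and> continuous_on UNIV \<phi>}"

definition positive_functional :: "('a::unital_cstar_algebra \<Rightarrow> complex) \<Rightarrow> bool" where
  "positive_functional \<phi> \<longleftrightarrow> (\<forall>p. positive_elem p \<longrightarrow> \<phi> p \<in> \<real>\<^sub>\<ge>\<^sub>0)"

definition a_states :: "'a::unital_cstar_algebra \<Rightarrow> ('a \<Rightarrow> complex) set" where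
  "a_states a = {\<phi> \<in> topological_dual. positive_functional \<phi> \<and> \<phi> a = 1}"

text \<open>The two suprema below are taken in the reals. They are meaningful (nonempty and bounded
  sets) when \<open>a\<close> is positive and invertible. For positive \<open>a\<close> the value \<open>\<phi> (star x * a * x)\<close> is a
  nonnegative real, so taking its real part loses nothing.\<close>

definition a_norm :: "'a::unital_cstar_algebra \<Rightarrow> 'a \<Rightarrow> real" where
  "a_norm a x = (SUP \<phi>\<in>a_states a. sqrt (Re (\<phi> (star x * a * x))))"

definition a_numerical_radius :: "'a::unital_cstar_algebra \<Rightarrow> 'a \<Rightarrow> real" where
  "a_numerical_radius a x = (SUP \<phi>\<in>a_states a. cmod (\<phi> (a * x)))"

definition a_norm_parallel :: "'a::unital_cstar_algebra \<Rightarrow> 'a \<Rightarrow> 'a \<Rightarrow> bool" where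
  "a_norm_parallel a x y \<longleftrightarrow>
    (\<exists>\<mu>. cmod \<mu> = 1 \<and> a_norm a (x + \<mu> *\<^sub>C y) = a_norm a x + a_norm a y)"

definition a_numerical_radius_parallel :: "'a::unital_cstar_algebra \<Rightarrow> 'a \<Rightarrow> 'a \<Rightarrow> bool" where
  "a_numerical_radius_parallel a x y \<longleftrightarrow>
    (\<exists>\<mu>. cmod \<mu> = 1 \<and>
      a_numerical_radius a (x + \<mu> *\<^sub>C y) = a_numerical_radius a x + a_numerical_radius a y)"

end

theory Submission
  imports Defs "HOL-Computational_Algebra.Fundamental_Theorem_Algebra"
begin

text \<open>
  The set of \<open>a\<close>-states is nonempty and compact in the topology of pointwise convergence
  (\<open>a_states_nonempty\<close>, \<open>compact_a_states\<close>), so the suprema defining \<open>a_norm\<close> and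
  \<open>a_numerical_radius\<close> are attained. If \<open>x + \<mu> y\<close> attains the sum of the two seminorms, then a state
  \<open>\<phi>\<close> attaining its seminorm gives equality in the triangle inequality for the complex numbers
  \<open>\<phi> (a * x)\<close> and \<open>\<mu> * \<phi> (a * y)\<close>, or for the semi-inner product
  \<open>(u, v) \<mapsto> \<phi> (star u * a * v)\<close>; the equality cases, the second one through the Cauchy--Schwarz
  inequality, are the stated equations. Conversely, these equations say that \<open>\<phi>\<close> attains the sum, and
  the triangle inequality gives the other estimate. For the numerical radius the case that
  one of the two radii is 0 is separate, since the equation is then trivial.

  Positivity is defined by the spectrum, and three facts about it are needed. First,
  \<open>a - c\<close> is positive for some \<open>c > 0\<close>, which bounds \<open>\<phi> 1\<close> and hence \<open>\<phi>\<close> uniformly over the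
  \<open>a\<close>-states. Second, there is a state: this follows from the Hahn--Banach theorem, proved by
  taking a minimal sublinear functional, and from the norm criterion \<open>positive_elem_iff_norm\<close>. Third,
  \<open>star x * a * x\<close> is positive, which follows from a self-adjoint square root of \<open>a\<close>
  (\<open>positive_invertible_sqrt\<close>) and the positivity of \<open>star b * b\<close> (\<open>positive_elem_star_mult\<close>).
  The norm criterion, which also shows that sums of positive elements are positive, and the square
  root both rest on the fact that the norm of a self-adjoint element is its spectral radius
  (\<open>selfadjoint_norm_le_spectral_radius\<close>).
\<close>

section \<open>The complex vector space structure and the involution\<close>

interpretation scaleC: vector_space "scaleC :: complex \<Rightarrow> 'a::unital_cstar_algebra \<Rightarrow> 'a"
  by unfold_locales
    (auto simp: scaleC_add_right scaleC_add_left scaleC_scaleC scaleC_of_real[of 1, simplified])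

lemma star_zero [simp]: "star (0::'a::unital_cstar_algebra) = 0"
  using star_add[of "0::'a" 0] by simp

lemma star_minus [simp]: "star (- x) = - star (x::'a::unital_cstar_algebra)"
  using star_add[of x "- x"] by (simp add: eq_neg_iff_add_eq_0 add.commute)

lemma star_diff: "star (x - y) = star x - star (y::'a::unital_cstar_algebra)"
  using star_add[of x "- y"] by simp

lemma star_one [simp]: "star (1::'a::unital_cstar_algebra) = 1"
  by (metis mult_1 star_mult star_star)

lemma star_scaleR [simp]: "star (r *\<^sub>R x) = r *\<^sub>R star (x::'a::unital_cstar_algebra)"
  by (metis complex_cnj_complex_of_real scaleC_of_real star_scaleC)

lemma star_power: "star (x ^ n) = star (x::'a::unital_cstar_algebra) ^ n"
  by (induction n) (auto simp: star_mult power_commutes)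

lemma norm_star [simp]: "norm (star x) = norm (x::'a::unital_cstar_algebra)"
proof -
  have le: "norm y \<le> norm (star y)" for y :: 'a
  proof (cases "y = 0")
    case False
    have "norm y * norm y \<le> norm (star y) * norm y"
      using cstar_identity[of y] norm_mult_ineq[of "star y" y] by (simp add: power2_eq_square)
    then show ?thesis using False by simp
  qed simp
  show ?thesis using le[of x] le[of "star x"] by (simp add: star_star)
qed

lemma continuous_on_star: "continuous_on S (star :: 'a::unital_cstar_algebra \<Rightarrow> 'a)"
  by (rule bounded_linear.continuous_on, rule bounded_linear_intro[where K = 1])
     (auto simp: star_add)

lemma scaleC_scaleR: "c *\<^sub>C r *\<^sub>R x = r *\<^sub>R c *\<^sub>C (x::'a::unital_cstar_algebra)"
  by (metis mult.commute scaleC_of_real scaleC_scaleC)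

section \<open>Invertibility and spectrum\<close>

lemma invertible_elemI: "a * b = 1 \<Longrightarrow> b * a = 1 \<Longrightarrow> invertible_elem a"
  by (auto simp: invertible_elem_def)

lemma invertible_elem_mult:
  fixes a b :: "'a::monoid_mult"
  assumes "invertible_elem a" "invertible_elem b"
  shows "invertible_elem (a * b)"
proof -
  obtain a' b' where "a * a' = 1" "a' * a = 1" "b * b' = 1" "b' * b = 1"
    using assms by (auto simp: invertible_elem_def)
  then have "(a * b) * (b' * a') = 1" "(b' * a') * (a * b) = 1"
    by (metis mult.assoc mult_1)+
  then show ?thesis by (rule invertible_elemI)
qed

lemma invertible_elem_commuting_factor:
  fixes a b :: "'a::monoid_mult"
  assumes "a * b = b * a" "invertible_elem (a * b)"
  shows "invertible_elem a"
proof -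
  obtain c where c: "a * b * c = 1" "c * (a * b) = 1"
    using assms(2) by (auto simp: invertible_elem_def)
  have r: "a * (b * c) = 1" using c by (simp add: mult.assoc)
  have l: "c * b * a = 1" using c assms(1) by (simp add: mult.assoc)
  have "c * b = b * c" using r l by (metis mult.assoc mult_1 mult.right_neutral)
  then show ?thesis using r l by (intro invertible_elemI[of a "b * c"]) auto
qed

lemma invertible_elem_scaleC:
  fixes a :: "'a::unital_cstar_algebra"
  assumes "c \<noteq> 0"
  shows "invertible_elem (c *\<^sub>C a) \<longleftrightarrow> invertible_elem a"
proof -
  have "invertible_elem (d *\<^sub>C b)" if b: "invertible_elem b" and d: "d \<noteq> 0" for d and b :: 'a
  proof -
    obtain b' where "b * b' = 1" "b' * b = 1" using b by (auto simp: invertible_elem_def)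
    then show ?thesis using d
      by (intro invertible_elemI[of _ "inverse d *\<^sub>C b'"])
         (auto simp: mult_scaleC_left mult_scaleC_right scaleC_scaleC)
  qed
  from this[of a c] this[of "c *\<^sub>C a" "inverse c"] show ?thesis
    using assms by (auto simp: scaleC_scaleC)
qed

lemma invertible_elem_minus: "invertible_elem (- a) \<longleftrightarrow> invertible_elem (a::'a::unital_cstar_algebra)"
  using invertible_elem_scaleC[of "-1" a] by simp

lemma spectrum_diff_scaleC_one:
  "z \<in> spectrum (a - w *\<^sub>C 1) \<longleftrightarrow> z + w \<in> spectrum (a::'a::unital_cstar_algebra)"
  by (simp add: spectrum_def scaleC_add_left algebra_simps)

lemma spectrum_minus: "z \<in> spectrum (- a) \<longleftrightarrow> - z \<in> spectrum (a::'a::unital_cstar_algebra)"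
proof -
  have "- a - z *\<^sub>C 1 = - (a - (- z) *\<^sub>C 1)" by simp
  then show ?thesis unfolding spectrum_def mem_Collect_eq by (metis invertible_elem_minus)
qed

lemma spectrum_scaleR_one_minus:
  "z \<in> spectrum (t *\<^sub>R 1 - a) \<longleftrightarrow> of_real t - z \<in> spectrum (a::'a::unital_cstar_algebra)"
  using spectrum_minus[of z "a - of_real t *\<^sub>C 1"]
    spectrum_diff_scaleC_one[of "- z" a "of_real t"]
  by (simp add: scaleC_of_real)

lemma spectrum_scaleC:
  assumes "c \<noteq> 0"
  shows "z \<in> spectrum (c *\<^sub>C a) \<longleftrightarrow> z / c \<in> spectrum (a::'a::unital_cstar_algebra)"
proof -
  have "c *\<^sub>C a - z *\<^sub>C 1 = c *\<^sub>C (a - (z / c) *\<^sub>C 1)"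
    using assms by (simp add: scaleC.scale_right_diff_distrib)
  then show ?thesis
    using invertible_elem_scaleC[OF assms] by (simp add: spectrum_def)
qed

lemma invertible_one_minus:
  fixes x :: "'a::unital_cstar_algebra"
  assumes "norm x < 1"
  shows "invertible_elem (1 - x)"
proof -
  have s: "summable (\<lambda>n. x ^ n)" by (rule complete_algebra_summable_geometric[OF assms])
  define S where "S = (\<Sum>n. x ^ n)"
  have tail: "(\<Sum>n. x ^ Suc n) = S - 1"
    using suminf_split_head[OF s] by (simp add: S_def)
  have "x * S = S - 1"
    using suminf_mult[OF s, of x] tail by (simp add: S_def)
  moreover have "S * x = S - 1"
    using suminf_mult2[OF s, of x] tail by (simp add: S_def power_commutes)
  ultimately show ?thesis
    by (intro invertible_elemI[of _ S]) (auto simp: algebra_simps)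
qed

lemma spectrum_norm_le:
  fixes a :: "'a::unital_cstar_algebra"
  assumes "z \<in> spectrum a"
  shows "cmod z \<le> norm a"
proof (rule ccontr)
  assume "\<not> ?thesis"
  then have z: "cmod z > norm a" "z \<noteq> 0" using norm_ge_zero[of a] by auto
  then have "invertible_elem (1 - inverse z *\<^sub>C a)"
    by (intro invertible_one_minus) (simp add: norm_scaleC norm_divide inverse_eq_divide)
  moreover have "a - z *\<^sub>C 1 = (- z) *\<^sub>C (1 - inverse z *\<^sub>C a)"
    using z(2) by (simp add: scaleC.scale_right_diff_distrib)
  ultimately show False
    using assms z(2) by (simp add: spectrum_def invertible_elem_scaleC del: scaleC.scale_minus_left)
qed

text \<open>For self-adjoint \<open>h\<close> the C*-identity bounds the norm of \<open>h + \<i>n\<close> exactly as if \<open>h\<close> were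
  a real number. This estimate makes both the spectrum of \<open>h\<close> and the values of states on \<open>h\<close>
  real.\<close>
lemma norm_selfadjoint_plus_imaginary:
  fixes h :: "'a::unital_cstar_algebra"
  assumes "star h = h"
  shows "(norm (h + (\<i> * of_real n) *\<^sub>C 1))\<^sup>2 \<le> (norm h)\<^sup>2 + n\<^sup>2"
proof -
  let ?k = "h + (\<i> * of_real n) *\<^sub>C 1"
  have sq: "(\<i> * of_real n) * (\<i> * of_real n) = - (of_real (n\<^sup>2) :: complex)"
    by (simp add: power2_eq_square algebra_simps)
  have "star ?k * ?k = (h - (\<i> * of_real n) *\<^sub>C 1) * ?k"
    by (simp add: star_add star_scaleC assms)
  also have "\<dots> = h * h + (of_real (n\<^sup>2) :: complex) *\<^sub>C 1"
    by (simp add: ring_distribs mult_scaleC_left mult_scaleC_right scaleC_scaleC sq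
        scaleC.scale_right_diff_distrib del: of_real_power)
  finally have "(norm ?k)\<^sup>2 = norm (h * h + n\<^sup>2 *\<^sub>R 1)"
    using cstar_identity[of ?k] by (simp only: scaleC_of_real)
  also have "\<dots> \<le> norm (h * h) + norm (n\<^sup>2 *\<^sub>R (1::'a))" by (rule norm_triangle_ineq)
  also have "\<dots> = (norm h)\<^sup>2 + n\<^sup>2" using cstar_identity[of h] assms by simp
  finally show ?thesis .
qed

lemma selfadjoint_spectrum_Reals:
  fixes h :: "'a::unital_cstar_algebra"
  assumes "star h = h" "z \<in> spectrum h"
  shows "z \<in> \<real>"
proof -
  \<comment> \<open>Compare the translate \<open>z + \<i>n\<close>, which lies in the spectrum of \<open>h + \<i>n\<close>, with the norm.\<close>
  have key: "2 * Im z * n \<le> (norm h)\<^sup>2" for n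
  proof -
    have "z + \<i> * of_real n \<in> spectrum (h + (\<i> * of_real n) *\<^sub>C 1)"
      using spectrum_diff_scaleC_one[of "z + \<i> * of_real n" h "- (\<i> * of_real n)"] assms(2) by simp
    then have "(cmod (z + \<i> * of_real n))\<^sup>2 \<le> (norm (h + (\<i> * of_real n) *\<^sub>C 1))\<^sup>2"
      by (intro power_mono spectrum_norm_le) auto
    also have "\<dots> \<le> (norm h)\<^sup>2 + n\<^sup>2" by (rule norm_selfadjoint_plus_imaginary[OF assms(1)])
    finally have "(Re z)\<^sup>2 + (Im z + n)\<^sup>2 \<le> (norm h)\<^sup>2 + n\<^sup>2" by (simp add: cmod_power2)
    moreover have "(Im z + n)\<^sup>2 = (Im z)\<^sup>2 + n\<^sup>2 + 2 * Im z * n" by (simp add: power2_sum)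
    ultimately show ?thesis using zero_le_power2[of "Re z"] zero_le_power2[of "Im z"] by linarith
  qed
  have "Im z = 0"
  proof (rule ccontr)
    assume "Im z \<noteq> 0"
    then show False using key[of "((norm h)\<^sup>2 + 1) / (2 * Im z)"] by simp
  qed
  then show ?thesis by (simp add: complex_is_Real_iff)
qed

lemma positive_elem_iff_Re:
  fixes h :: "'a::unital_cstar_algebra"
  assumes "star h = h"
  shows "positive_elem h \<longleftrightarrow> (\<forall>z\<in>spectrum h. 0 \<le> Re z)"
  using assms selfadjoint_spectrum_Reals[OF assms]
  by (force simp: positive_elem_def complex_nonneg_Reals_iff complex_is_Real_iff)

section \<open>Norm and spectral radius of self-adjoint elements\<close>

text \<open>The identity \<open>2 / (1 - g\<^sup>2) = 1 / (1 - g) + 1 / (1 + g)\<close>, with the inverses given explicitly.\<close>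
lemma inverse_one_minus_square:
  fixes g :: "'a::unital_cstar_algebra"
  assumes A: "A * (1 - g) = 1" "(1 - g) * A = 1"
    and B: "B * (1 + g) = 1" "(1 + g) * B = 1"
  shows "((1/2) *\<^sub>R (A + B)) * (1 - g * g) = 1" "(1 - g * g) * ((1/2) *\<^sub>R (A + B)) = 1"
proof -
  have f: "1 - g * g = (1 - g) * (1 + g)" "1 - g * g = (1 + g) * (1 - g)"
    by (simp_all add: algebra_simps)
  have two: "(1 + g) + (1 - g) = (2::real) *\<^sub>R 1" by (simp add: scaleR_2)
  have "(A + B) * (1 - g * g) = (A * (1 - g)) * (1 + g) + (B * (1 + g)) * (1 - g)"
    by (metis distrib_right f mult.assoc)
  also have "\<dots> = 2 *\<^sub>R 1" using A B two by simp
  finally show "((1/2) *\<^sub>R (A + B)) * (1 - g * g) = 1" by simp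
  have "(1 - g * g) * (A + B) = (1 + g) * ((1 - g) * A) + (1 - g) * ((1 + g) * B)"
    by (metis distrib_left f mult.assoc)
  also have "\<dots> = 2 *\<^sub>R 1" using A B two by simp
  finally show "(1 - g * g) * ((1/2) *\<^sub>R (A + B)) = 1" by simp
qed

lemma norm_selfadjoint_power_2:
  fixes h :: "'a::unital_cstar_algebra"
  assumes "star h = h"
  shows "norm (h ^ 2 ^ m) = norm h ^ 2 ^ m"
proof (induction m)
  case (Suc m)
  have "h ^ 2 ^ Suc m = star (h ^ 2 ^ m) * h ^ 2 ^ m"
    by (simp add: star_power assms power_add[symmetric] mult_2)
  then show ?case
    using Suc cstar_identity[of "h ^ 2 ^ m"] by (simp add: power_mult[symmetric] mult.commute)
qed simp

text \<open>Any choice \<open>F w\<close> of inverses of \<open>1 - w k\<close> is continuous, by the resolvent identity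
  \<open>F v - F w = (v - w) F v k F w\<close>.\<close>
lemma continuous_on_resolvent:
  fixes k :: "'a::unital_cstar_algebra"
  assumes F: "\<And>w. w \<in> S \<Longrightarrow> F w * (1 - w *\<^sub>C k) = 1 \<and> (1 - w *\<^sub>C k) * F w = 1"
  shows "continuous_on S F"
  unfolding continuous_on_iff
proof (intro ballI allI impI)
  fix w and e :: real assume w: "w \<in> S" and e: "0 < e"
  have diff: "norm (F v - F w) \<le> cmod (v - w) * norm (F v) * norm k * norm (F w)"
    if v: "v \<in> S" for v
  proof -
    have "(1 - w *\<^sub>C k) - (1 - v *\<^sub>C k) = (v - w) *\<^sub>C k"
      by (simp add: scaleC.scale_left_diff_distrib)
    then have "F v * ((v - w) *\<^sub>C k) * F w
        = F v * ((1 - w *\<^sub>C k) * F w) - F v * (1 - v *\<^sub>C k) * F w"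
      by (metis left_diff_distrib mult.assoc right_diff_distrib)
    also have "\<dots> = F v - F w" using F[OF v] F[OF w] by simp
    finally have "norm (F v - F w) = norm (F v * ((v - w) *\<^sub>C k) * F w)" by simp
    also have "\<dots> \<le> norm (F v) * norm ((v - w) *\<^sub>C k) * norm (F w)"
      by (meson mult_right_mono norm_ge_zero norm_mult_ineq order_trans)
    finally show ?thesis by (simp add: norm_scaleC mult.assoc mult.left_commute)
  qed
  define c where "c = norm k * norm (F w)"
  have c0: "c \<ge> 0" by (simp add: c_def)
  \<comment> \<open>The first bound on \<open>d\<close> gives \<open>norm (F v) \<le> 2 * norm (F w)\<close>, the second the final estimate.\<close>
  define d where "d = min (1 / (2 * (c + 1))) (e / (2 * (norm (F w) * c + 1)))"
  have pos: "norm (F w) * c + 1 > 0" using c0 by (smt (verit) mult_nonneg_nonneg norm_ge_zero)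
  have d: "d > 0" unfolding d_def min_less_iff_conj using c0 e pos
    by (intro conjI divide_pos_pos mult_pos_pos) auto
  show "\<exists>d>0. \<forall>v\<in>S. dist v w < d \<longrightarrow> dist (F v) (F w) < e"
  proof (rule exI[of _ d], intro conjI ballI impI)
    show "0 < d" by (rule d)
  next
    fix v assume v: "v \<in> S" and "dist v w < d"
    then have vd: "cmod (v - w) < d" by (simp add: dist_norm)
    have D: "norm (F v - F w) \<le> cmod (v - w) * c * norm (F v)"
      using diff[OF v] by (simp add: c_def ac_simps)
    have "cmod (v - w) * c \<le> 1 / (2 * (c + 1)) * c"
      using vd c0 by (intro mult_right_mono) (auto simp: d_def)
    also have "\<dots> \<le> 1 / 2" using c0 by (simp add: divide_simps)
    finally have "cmod (v - w) * c * norm (F v) \<le> 1 / 2 * norm (F v)"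
      by (rule mult_right_mono) simp
    then have "norm (F v) \<le> 2 * norm (F w)"
      using D norm_triangle_ineq2[of "F v" "F w"] by linarith
    then have "norm (F v - F w) \<le> cmod (v - w) * c * (2 * norm (F w))"
      using D c0 by (meson mult_left_mono mult_nonneg_nonneg norm_ge_zero order_trans)
    also have "\<dots> \<le> cmod (v - w) * (2 * (norm (F w) * c + 1))"
      using mult_nonneg_nonneg[OF norm_ge_zero[of "v - w"], of 2] by (simp add: algebra_simps)
    also have "\<dots> < d * (2 * (norm (F w) * c + 1))"
      using vd pos by (intro mult_strict_right_mono) auto
    also have "\<dots> \<le> e / (2 * (norm (F w) * c + 1)) * (2 * (norm (F w) * c + 1))"
      using pos by (intro mult_right_mono) (auto simp: d_def)
    also have "\<dots> = e" using pos by simp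
    finally show "dist (F v) (F w) < e" by (simp add: dist_norm)
  qed
qed

text \<open>The spectral radius of a self-adjoint element is its norm; this is the normalised case, proved
  without complex function theory. If the spectrum of \<open>k\<close> lay in the open unit disc, then
  \<open>F w = 1 / (1 - w k)\<close> would exist and be uniformly continuous on the closed disc, so that for some
  \<open>r < 1\<close> the elements \<open>F w\<close> and \<open>F (r w)\<close> are close for all \<open>w\<close> on the unit circle.
  Averaging over \<open>w\<close> and \<open>- w\<close> carries the same bound over to
  \<open>1 / (1 - w\<^sup>2 k\<^sup>2)\<close> and \<open>1 / (1 - r\<^sup>2 w\<^sup>2 k\<^sup>2)\<close>, and inductively to all powers \<open>2 ^ m\<close>. As
  \<open>r ^ 2 ^ m\<close> tends to 0, the inverse of \<open>1 - k ^ 2 ^ m\<close> is eventually close to 1, so that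
  \<open>k ^ 2 ^ m\<close> has norm less than 1. This contradicts \<open>norm (k ^ 2 ^ m) = norm k ^ 2 ^ m = 1\<close>.\<close>
lemma selfadjoint_unit_spectrum:
  fixes k :: "'a::unital_cstar_algebra"
  assumes sa: "star k = k" and n1: "norm k = 1"
  shows "\<exists>z\<in>spectrum k. cmod z \<ge> 1"
proof (rule ccontr)
  assume neg: "\<not> ?thesis"
  have inv: "invertible_elem (1 - w *\<^sub>C k)" if "w \<in> cball 0 1" for w
  proof (cases "w = 0")
    case True
    then show ?thesis by (auto simp: invertible_elem_def)
  next
    case False
    have "cmod (inverse w) \<ge> 1" using that False by (simp add: norm_inverse one_le_inverse)
    then have "inverse w \<notin> spectrum k" using neg by auto
    then have "invertible_elem ((- w) *\<^sub>C (k - inverse w *\<^sub>C 1))"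
      using False by (simp add: spectrum_def invertible_elem_scaleC del: scaleC.scale_minus_left)
    moreover have "(- w) *\<^sub>C (k - inverse w *\<^sub>C 1) = 1 - w *\<^sub>C k"
      using False by (simp add: scaleC.scale_right_diff_distrib)
    ultimately show ?thesis by simp
  qed
  define F where "F w = (SOME b. b * (1 - w *\<^sub>C k) = 1 \<and> (1 - w *\<^sub>C k) * b = 1)" for w
  have F: "F w * (1 - w *\<^sub>C k) = 1 \<and> (1 - w *\<^sub>C k) * F w = 1" if "w \<in> cball 0 1" for w
    unfolding F_def using inv[OF that] unfolding invertible_elem_def
    by (rule_tac someI_ex) blast
  have "uniformly_continuous_on (cball 0 1) F"
    by (intro compact_uniformly_continuous continuous_on_resolvent[of _ _ k] F compact_cball)
  then obtain d where d: "d > 0" and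
    dF: "\<And>v w. v \<in> cball 0 1 \<Longrightarrow> w \<in> cball 0 1 \<Longrightarrow> dist v w < d \<Longrightarrow> dist (F v) (F w) < 1 / 4"
    unfolding uniformly_continuous_on_def by (metis zero_less_divide_1_iff zero_less_numeral)
  define r where "r = max 0 (1 - d / 2)"
  have r: "0 \<le> r" "r < 1" "1 - r < d" using d by (auto simp: r_def)
  have close: "\<exists>A B. A * (1 - w *\<^sub>C k ^ 2 ^ m) = 1 \<and> (1 - w *\<^sub>C k ^ 2 ^ m) * A = 1
      \<and> B * (1 - (of_real (r ^ 2 ^ m) * w) *\<^sub>C k ^ 2 ^ m) = 1
      \<and> (1 - (of_real (r ^ 2 ^ m) * w) *\<^sub>C k ^ 2 ^ m) * B = 1
      \<and> norm (A - B) \<le> 1 / 4" if "cmod w = 1" for m w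
    using that
  proof (induction m arbitrary: w)
    case 0
    have "w \<in> cball 0 1" "of_real r * w \<in> cball 0 1" using 0 r by (auto simp: norm_mult)
    moreover have "dist w (of_real r * w) < d"
    proof -
      have "w - of_real r * w = of_real (1 - r) * w" by (simp add: algebra_simps)
      then have "dist w (of_real r * w) = cmod (of_real (1 - r)) * cmod w"
        by (simp only: dist_norm norm_mult)
      then show ?thesis using 0 r by (simp only: norm_of_real) simp
    qed
    ultimately show ?case
      using F[of w] F[of "of_real r * w"] dF[of w "of_real r * w"]
      by (intro exI[of _ "F w"] exI[of _ "F (of_real r * w)"]) (auto simp: dist_norm less_imp_le)
  next
    case (Suc m)
    \<comment> \<open>Every point of the unit circle is the square of another one.\<close>
    define v where "v = csqrt w"
    have v: "v * v = w" "cmod v = 1" "cmod (- v) = 1"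
      using Suc.prems power2_csqrt[of w] by (auto simp: v_def power2_eq_square)
    let ?g = "k ^ 2 ^ m" and ?q = "of_real (r ^ 2 ^ m) :: complex"
    obtain A B where 1: "A * (1 - v *\<^sub>C ?g) = 1" "(1 - v *\<^sub>C ?g) * A = 1"
      "B * (1 - (?q * v) *\<^sub>C ?g) = 1" "(1 - (?q * v) *\<^sub>C ?g) * B = 1" "norm (A - B) \<le> 1 / 4"
      using Suc.IH[OF v(2)] by auto
    obtain A' B' where 2: "A' * (1 - (- v) *\<^sub>C ?g) = 1" "(1 - (- v) *\<^sub>C ?g) * A' = 1"
      "B' * (1 - (?q * - v) *\<^sub>C ?g) = 1" "(1 - (?q * - v) *\<^sub>C ?g) * B' = 1" "norm (A' - B') \<le> 1 / 4"
      using Suc.IH[OF v(3)] by blast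
    have g: "(v *\<^sub>C ?g) * (v *\<^sub>C ?g) = w *\<^sub>C k ^ 2 ^ Suc m"
      "((?q * v) *\<^sub>C ?g) * ((?q * v) *\<^sub>C ?g) = (of_real (r ^ 2 ^ Suc m) * w) *\<^sub>C k ^ 2 ^ Suc m"
    proof -
      have gg: "?g * ?g = k ^ 2 ^ Suc m" by (simp add: power_add[symmetric] mult_2)
      have "?q * ?q = of_real (r ^ 2 ^ Suc m)"
        by (simp add: power_add[symmetric] mult_2)
      then have qq: "(?q * v) * (?q * v) = of_real (r ^ 2 ^ Suc m) * w"
        by (metis mult.assoc mult.left_commute v(1))
      show "(v *\<^sub>C ?g) * (v *\<^sub>C ?g) = w *\<^sub>C k ^ 2 ^ Suc m"
        by (simp only: mult_scaleC_left mult_scaleC_right scaleC_scaleC gg v(1))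
      show "((?q * v) *\<^sub>C ?g) * ((?q * v) *\<^sub>C ?g) = (of_real (r ^ 2 ^ Suc m) * w) *\<^sub>C k ^ 2 ^ Suc m"
        by (simp only: mult_scaleC_left mult_scaleC_right scaleC_scaleC gg qq)
    qed
    have "(1/2) *\<^sub>R (A + A') - (1/2) *\<^sub>R (B + B') = (1/2) *\<^sub>R ((A - B) + (A' - B'))"
      by (simp add: scaleR_diff_right scaleR_add_right)
    then have "norm ((1/2) *\<^sub>R (A + A') - (1/2) *\<^sub>R (B + B')) = norm ((A - B) + (A' - B')) / 2"
      by (simp only: norm_scaleR)
    also have "\<dots> \<le> 1 / 4" using norm_triangle_ineq[of "A - B" "A' - B'"] 1(5) 2(5) by linarith
    finally have n: "norm ((1/2) *\<^sub>R (A + A') - (1/2) *\<^sub>R (B + B')) \<le> 1 / 4" .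
    have 3: "A' * (1 + v *\<^sub>C ?g) = 1" "(1 + v *\<^sub>C ?g) * A' = 1"
      "B' * (1 + (?q * v) *\<^sub>C ?g) = 1" "(1 + (?q * v) *\<^sub>C ?g) * B' = 1"
      using 2(1-4) by (simp_all only: mult_minus_right scaleC.scale_minus_left diff_minus_eq_add)
    show ?case
      using inverse_one_minus_square[OF 1(1,2) 3(1,2)] inverse_one_minus_square[OF 1(3,4) 3(3,4)] n
      unfolding g by blast
  qed
  \<comment> \<open>\<open>1 / 8\<close> is small enough to keep the inverse \<open>A\<close> of \<open>1 - g\<close> below within \<open>2 / 5\<close> of 1.\<close>
  obtain m0 where m0: "r ^ m0 < 1 / 8" using real_arch_pow_inv[of "1/8" r] r by auto
  have "m0 \<le> 2 ^ m0" by (simp add: less_imp_le)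
  then have "r ^ 2 ^ m0 \<le> r ^ m0" using r by (intro power_decreasing) auto
  then have q: "0 \<le> r ^ 2 ^ m0" "r ^ 2 ^ m0 < 1 / 8" using m0 r by auto
  define g where "g = k ^ 2 ^ m0"
  define q where "q = r ^ 2 ^ m0"
  have g: "norm g = 1" using norm_selfadjoint_power_2[OF sa] n1 by (simp add: g_def)
  obtain A B where AB: "A * (1 - g) = 1" "B * (1 - q *\<^sub>R g) = 1" "norm (A - B) \<le> 1 / 4"
    using close[of 1 m0] by (auto simp: g_def q_def scaleC_of_real simp del: of_real_power)
  have "B - 1 = B * (q *\<^sub>R g)" using AB(2) by (simp add: algebra_simps)
  then have B1: "norm (B - 1) \<le> q * norm B"
    using norm_mult_ineq[of B "q *\<^sub>R g"] g q by (simp add: q_def mult.commute)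
  moreover have "q * norm B \<le> 1 / 8 * norm B" using q by (intro mult_right_mono) (auto simp: q_def)
  moreover have "norm B \<le> norm (B - 1) + 1" using norm_triangle_ineq[of "B - 1" 1] by simp
  ultimately have "norm (B - 1) \<le> 1 / 7" by linarith
  then have A1: "norm (A - 1) \<le> 2 / 5"
    using AB(3) norm_triangle_ineq[of "A - B" "B - 1"] by simp
  have "g = (A - 1) - (A - 1) * g" using AB(1) by (simp add: algebra_simps)
  then have "norm g \<le> norm (A - 1) + norm ((A - 1) * g)" by (metis norm_triangle_ineq4)
  also have "\<dots> \<le> norm (A - 1) + norm (A - 1) * norm g" using norm_mult_ineq add_left_mono by blast
  also have "\<dots> < 1" using A1 g by simp
  finally show False using g by simp
qed

lemma selfadjoint_norm_le_spectral_radius: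
  fixes h :: "'a::unital_cstar_algebra"
  assumes sa: "star h = h" and s: "0 \<le> s" "\<And>z. z \<in> spectrum h \<Longrightarrow> cmod z \<le> s"
  shows "norm h \<le> s"
proof (rule ccontr)
  assume "\<not> ?thesis"
  then have N: "norm h > s" "norm h > 0" using s by auto
  define c where "c = (of_real (inverse (norm h)) :: complex)"
  have c: "c \<noteq> 0" "cmod c = inverse (norm h)" using N by (auto simp: c_def norm_inverse)
  obtain z where z: "z \<in> spectrum (c *\<^sub>C h)" "cmod z \<ge> 1"
    using selfadjoint_unit_spectrum[of "c *\<^sub>C h"] N sa c
    by (auto simp: star_scaleC norm_scaleC c_def simp del: of_real_inverse)
  have "cmod (z / c) \<le> s" using z(1) s(2) spectrum_scaleC[OF c(1)] by blast
  moreover have "cmod (z / c) = cmod z * norm h" using c by (simp add: norm_divide norm_mult norm_inverse divide_inverse)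
  moreover have "1 * norm h \<le> cmod z * norm h" using z(2) by (rule mult_right_mono) simp
  ultimately show False using N by linarith
qed

section \<open>The cone of positive elements\<close>

lemma positive_elem_star: "positive_elem a \<Longrightarrow> star a = a"
  by (simp add: positive_elem_def)

text \<open>This norm criterion makes the positive elements a convex cone, which the spectral definition
  does not show directly.\<close>
lemma positive_elem_iff_norm:
  fixes h :: "'a::unital_cstar_algebra"
  assumes sa: "star h = h" and t: "norm h \<le> t"
  shows "positive_elem h \<longleftrightarrow> norm (t *\<^sub>R 1 - h) \<le> t"
proof
  assume pos: "positive_elem h"
  show "norm (t *\<^sub>R 1 - h) \<le> t"
  proof (rule selfadjoint_norm_le_spectral_radius)
    show "star (t *\<^sub>R 1 - h) = t *\<^sub>R 1 - h" by (simp add: star_diff sa)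
    show "0 \<le> t" using t norm_ge_zero order_trans by blast
    fix z assume "z \<in> spectrum (t *\<^sub>R 1 - h)"
    then have w: "of_real t - z \<in> spectrum h" by (simp add: spectrum_scaleR_one_minus)
    obtain x where x: "of_real t - z = of_real x"
      using selfadjoint_spectrum_Reals[OF sa w] by (auto elim: Reals_cases)
    have "0 \<le> x" using pos w x by (auto simp: positive_elem_iff_Re[OF sa])
    moreover have "x \<le> t" using spectrum_norm_le[OF w] t x by simp
    moreover have "z = of_real (t - x)" using x by (simp add: algebra_simps)
    ultimately show "cmod z \<le> t" by (simp only: norm_of_real)
  qed
next
  assume n: "norm (t *\<^sub>R 1 - h) \<le> t"
  have "0 \<le> Re z" if "z \<in> spectrum h" for z
  proof -
    have "of_real t - z \<in> spectrum (t *\<^sub>R 1 - h)" using that by (simp add: spectrum_scaleR_one_minus)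
    then have "cmod (of_real t - z) \<le> t" using spectrum_norm_le n order_trans by blast
    then show ?thesis using complex_Re_le_cmod[of "of_real t - z"] by simp
  qed
  then show "positive_elem h" by (simp add: positive_elem_iff_Re[OF sa])
qed

lemma positive_elem_add:
  assumes "positive_elem p" "positive_elem (q::'a::unital_cstar_algebra)"
  shows "positive_elem (p + q)"
proof -
  have sa: "star p = p" "star q = q" using assms by (auto dest: positive_elem_star)
  have "norm (norm p *\<^sub>R 1 - p) \<le> norm p" "norm (norm q *\<^sub>R 1 - q) \<le> norm q"
    using assms positive_elem_iff_norm[OF sa(1), of "norm p"] positive_elem_iff_norm[OF sa(2), of "norm q"] by auto
  moreover have "(norm p + norm q) *\<^sub>R 1 - (p + q) = (norm p *\<^sub>R 1 - p) + (norm q *\<^sub>R 1 - q)"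
    by (simp add: scaleR_add_left)
  ultimately have "norm ((norm p + norm q) *\<^sub>R 1 - (p + q)) \<le> norm p + norm q"
    using norm_triangle_mono by metis
  then show ?thesis
    using positive_elem_iff_norm[of "p + q" "norm p + norm q"] sa norm_triangle_ineq[of p q]
    by (simp add: star_add)
qed

lemma positive_elem_scaleR:
  fixes p :: "'a::unital_cstar_algebra"
  assumes "0 < r"
  shows "positive_elem (r *\<^sub>R p) \<longleftrightarrow> positive_elem p"
proof -
  have *: "positive_elem (s *\<^sub>R q)" if "0 < s" "positive_elem q" for s and q :: 'a
  proof -
    have sa: "star q = q" using that positive_elem_star by auto
    have "0 \<le> Re z" if "z \<in> spectrum (s *\<^sub>R q)" for z
    proof -
      have "z / of_real s \<in> spectrum q"
        using that spectrum_scaleC[of "of_real s" z q] \<open>0 < s\<close> by (simp add: scaleC_of_real)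
      then have "0 \<le> Re z / s" using \<open>positive_elem q\<close> positive_elem_iff_Re[OF sa] by fastforce
      then show ?thesis using \<open>0 < s\<close> by (simp add: zero_le_divide_iff)
    qed
    then show ?thesis using sa by (simp add: positive_elem_iff_Re)
  qed
  show ?thesis using *[of r p] *[of "inverse r" "r *\<^sub>R p"] assms by auto
qed

lemma positive_elem_scaleR_one_minus:
  fixes h :: "'a::unital_cstar_algebra"
  assumes sa: "star h = h"
  shows "positive_elem (t *\<^sub>R 1 - h) \<longleftrightarrow> (\<forall>z\<in>spectrum h. Re z \<le> t)"
proof -
  have "positive_elem (t *\<^sub>R 1 - h) \<longleftrightarrow> (\<forall>z\<in>spectrum (t *\<^sub>R 1 - h). 0 \<le> Re z)"
    by (rule positive_elem_iff_Re) (simp add: star_diff sa)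
  also have "\<dots> \<longleftrightarrow> (\<forall>z. of_real t - z \<in> spectrum h \<longrightarrow> 0 \<le> Re z)"
    by (simp add: Ball_def spectrum_scaleR_one_minus)
  also have "\<dots> \<longleftrightarrow> (\<forall>z\<in>spectrum h. Re z \<le> t)"
  proof (intro iffI ballI allI impI)
    fix z assume "\<forall>z. of_real t - z \<in> spectrum h \<longrightarrow> 0 \<le> Re z" "z \<in> spectrum h"
    then show "Re z \<le> t" by (auto dest: spec[of _ "of_real t - z"])
  next
    fix z assume "\<forall>z\<in>spectrum h. Re z \<le> t" "of_real t - z \<in> spectrum h"
    then show "0 \<le> Re z" by fastforce
  qed
  finally show ?thesis .
qed

lemma positive_elem_norm_minus:
  fixes h :: "'a::unital_cstar_algebra"
  assumes "star h = h" "norm h \<le> t"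
  shows "positive_elem (t *\<^sub>R 1 - h)"
  unfolding positive_elem_scaleR_one_minus[OF assms(1)]
  using spectrum_norm_le complex_Re_le_cmod assms(2) by (meson order_trans)

section \<open>Polynomial calculus and spectral mapping\<close>

text \<open>The value of a complex polynomial at an algebra element, by Horner's scheme. The
  constant \<open>poly\<close> evaluates only at elements of the commutative coefficient ring.\<close>
definition poly_calculus :: "complex poly \<Rightarrow> 'a::unital_cstar_algebra \<Rightarrow> 'a" where
  "poly_calculus p h = fold_coeffs (\<lambda>c b. c *\<^sub>C 1 + h * b) p 0"

lemma poly_calculus_0 [simp]: "poly_calculus 0 h = 0"
  by (simp add: poly_calculus_def)

lemma poly_calculus_pCons [simp]:
  "poly_calculus (pCons c p) h = c *\<^sub>C 1 + h * poly_calculus p h"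
  by (cases "p = 0 \<and> c = 0") (auto simp: poly_calculus_def)

lemma poly_calculus_add: "poly_calculus (p + q) h = poly_calculus p h + poly_calculus q h"
  by (induction p q rule: poly_induct2) (auto simp: scaleC_add_left algebra_simps)

lemma poly_calculus_smult: "poly_calculus (smult c p) h = c *\<^sub>C poly_calculus p h"
  by (induction p) (auto simp: scaleC_add_right scaleC_scaleC mult_scaleC_right)

lemma poly_calculus_mult: "poly_calculus (p * q) h = poly_calculus p h * poly_calculus q h"
  by (induction p)
     (auto simp: poly_calculus_add poly_calculus_smult mult_scaleC_left distrib_right mult.assoc)

lemma poly_calculus_power: "poly_calculus (p ^ n) h = poly_calculus p h ^ n"
  by (induction n) (auto simp: poly_calculus_mult one_pCons)

lemma invertible_poly_calculus:
  fixes h :: "'a::unital_cstar_algebra"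
  assumes "p \<noteq> 0" "\<And>z. z \<in> spectrum h \<Longrightarrow> poly p z \<noteq> 0"
  shows "invertible_elem (poly_calculus p h)"
  using assms
proof (induction "degree p" arbitrary: p)
  case 0
  then obtain c where "p = [:c:]" "c \<noteq> 0" by (metis degree_eq_zeroE pCons_0_0)
  then show ?case
    using invertible_elem_scaleC[of c "1::'a"] by (auto simp: invertible_elem_def)
next
  case (Suc n)
  then have "\<not> constant (poly p)" by (simp add: constant_degree)
  then obtain r where r: "poly p r = 0" using fundamental_theorem_of_algebra by blast
  then obtain q where q: "p = [:- r, 1:] * q" by (auto simp: poly_eq_0_iff_dvd)
  have "q \<noteq> 0" using Suc.prems(1) q by auto
  then have "n = degree q" using Suc.hyps(2) unfolding q by (subst (asm) degree_mult_eq) auto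
  then have "invertible_elem (poly_calculus q h)"
    using Suc \<open>q \<noteq> 0\<close> q by (intro Suc.hyps(1)) auto
  moreover have "invertible_elem (h - r *\<^sub>C 1)"
    using Suc.prems(2) r by (auto simp: spectrum_def)
  moreover have "poly_calculus p h = (h - r *\<^sub>C 1) * poly_calculus q h"
    unfolding q poly_calculus_mult by simp
  ultimately show ?case by (simp add: invertible_elem_mult)
qed

text \<open>One half of the spectral mapping theorem. Constant polynomials are excluded, because for them
  the statement would need the spectrum to be nonempty.\<close>
lemma spectrum_poly_calculus_subset:
  assumes "0 < degree p" "w \<in> spectrum (poly_calculus p h)"
  shows "\<exists>z\<in>spectrum h. w = poly p z"
proof (rule ccontr)
  assume neg: "\<not> ?thesis"
  have "p + [:- w:] \<noteq> 0"
  proof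
    assume "p + [:- w:] = 0"
    then have "p = - [:- w:]" by (rule eq_neg_iff_add_eq_0[THEN iffD2])
    then have "p = [:w:]" by simp
    then show False using assms(1) by simp
  qed
  then have "invertible_elem (poly_calculus (p + [:- w:]) h)"
    using neg by (intro invertible_poly_calculus) auto
  then show False using assms(2) by (simp add: spectrum_def poly_calculus_add)
qed

lemma poly_in_spectrum_poly_calculus:
  assumes "z \<in> spectrum h"
  shows "poly p z \<in> spectrum (poly_calculus p h)"
proof (rule ccontr)
  assume "\<not> ?thesis"
  then have inv: "invertible_elem (poly_calculus (p + [:- poly p z:]) h)"
    by (simp add: spectrum_def poly_calculus_add)
  have "poly (p + [:- poly p z:]) z = 0" by simp
  then obtain q where q: "p + [:- poly p z:] = [:- z, 1:] * q"
    unfolding poly_eq_0_iff_dvd dvd_def by blast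
  have 1: "poly_calculus ([:- z, 1:] * q) h = (h - z *\<^sub>C 1) * poly_calculus q h"
    unfolding poly_calculus_mult by simp
  have 2: "poly_calculus ([:- z, 1:] * q) h = poly_calculus q h * (h - z *\<^sub>C 1)"
    unfolding mult.commute[of "[:- z, 1:]"] poly_calculus_mult by simp
  have "invertible_elem (h - z *\<^sub>C 1)"
    by (rule invertible_elem_commuting_factor[OF trans[OF 1[symmetric] 2]])
       (use inv in \<open>simp only: q 1\<close>)
  then show False using assms by (simp add: spectrum_def)
qed

lemma positive_elem_square:
  fixes h :: "'a::unital_cstar_algebra"
  assumes sa: "star h = h"
  shows "positive_elem (h * h)"
proof -
  have pc: "poly_calculus [:0, 0, 1:] h = h * h" by simp
  have "0 \<le> Re w" if w: "w \<in> spectrum (h * h)" for w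
  proof -
    obtain z where z: "z \<in> spectrum h" "w = poly [:0, 0, 1:] z"
      using spectrum_poly_calculus_subset[of "[:0, 0, 1:]" w h] w pc by auto
    then obtain x where "z = of_real x"
      using selfadjoint_spectrum_Reals[OF sa] by (auto elim: Reals_cases)
    then show ?thesis using z by simp
  qed
  then show ?thesis using sa by (simp add: positive_elem_iff_Re star_mult)
qed

section \<open>Positivity of \<open>star b * b\<close>\<close>

lemma invertible_one_minus_mult_swap:
  fixes x y :: "'a::unital_cstar_algebra"
  assumes "invertible_elem (1 - x * y)"
  shows "invertible_elem (1 - y * x)"
proof -
  obtain c where c: "(1 - x * y) * c = 1" "c * (1 - x * y) = 1"
    using assms by (auto simp: invertible_elem_def)
  have 1: "x * y * c = c - 1" "c * x * y = c - 1" using c by (auto simp: algebra_simps)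
  have "(1 - y * x) * (1 + y * c * x) = 1 + y * c * x - y * x - y * (x * y * c) * x"
    by (simp add: algebra_simps)
  also have "\<dots> = 1" unfolding 1 by (simp add: algebra_simps)
  finally have r: "(1 - y * x) * (1 + y * c * x) = 1" .
  have "(1 + y * c * x) * (1 - y * x) = 1 + y * c * x - y * x - y * (c * x * y) * x"
    by (simp add: algebra_simps)
  also have "\<dots> = 1" unfolding 1 by (simp add: algebra_simps)
  finally show ?thesis using r by (intro invertible_elemI)
qed

text \<open>Away from 0, the products \<open>x * y\<close> and \<open>y * x\<close> have the same spectrum.\<close>
lemma spectrum_mult_swap:
  fixes x y :: "'a::unital_cstar_algebra"
  assumes "z \<in> spectrum (x * y)" "z \<noteq> 0"
  shows "z \<in> spectrum (y * x)"
proof -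
  have eq: "u * v - z *\<^sub>C 1 = (- z) *\<^sub>C (1 - (inverse z *\<^sub>C u) * v)" for u v :: 'a
    using assms(2) by (simp add: scaleC.scale_right_diff_distrib mult_scaleC_left)
  have iff: "z \<in> spectrum (u * v) \<longleftrightarrow> \<not> invertible_elem (1 - (inverse z *\<^sub>C u) * v)" for u v :: 'a
    unfolding spectrum_def eq mem_Collect_eq using assms(2) by (subst invertible_elem_scaleC) auto
  show ?thesis using assms(1) invertible_one_minus_mult_swap[of y "inverse z *\<^sub>C x"]
    unfolding iff by (auto simp: mult_scaleC_left mult_scaleC_right)
qed

text \<open>Suppose that the self-adjoint contraction \<open>h = star b * b\<close> has a spectral value \<open>l < 0\<close>. The
  polynomial \<open>t (1 - t) ^ (2 n)\<close> is at most 1 on \<open>[-1, 1]\<close>, but below \<open>-1\<close> at \<open>l\<close> for large \<open>n\<close>.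
  It is realised by \<open>star c * c\<close> with \<open>c = b (1 - h) ^ n\<close>, so \<open>star c * c \<le> 1\<close>, and then
  \<open>c * star c \<le> 1\<close> because the spectra agree up to 0. With the real and
  imaginary parts of \<open>c\<close>, the sum \<open>star c * c + c * star c\<close> is a positive combination of squares,
  hence \<open>star c * c \<ge> - 1\<close>, a contradiction.\<close>
lemma positive_elem_star_mult_contraction:
  fixes b :: "'a::unital_cstar_algebra"
  assumes b: "norm b \<le> 1"
  shows "positive_elem (star b * b)"
proof -
  define h where "h = star b * b"
  have sa: "star h = h" by (simp add: h_def star_mult star_star)
  have nh: "norm h \<le> 1" using b by (simp add: h_def cstar_identity power_le_one)
  have "0 \<le> Re z" if z: "z \<in> spectrum h" for z
  proof (rule ccontr)
    assume neg: "\<not> 0 \<le> Re z"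
    obtain l where l: "z = of_real l" "l < 0"
      using selfadjoint_spectrum_Reals[OF sa z] neg by (auto elim: Reals_cases)
    obtain n where n: "1 / (- l) < (1 - l) ^ n" using real_arch_pow[of "1 - l"] l by auto
    have "(1 - l) ^ n \<le> (1 - l) ^ (2 * n)" using l by (intro power_increasing) auto
    then have "1 / (- l) < (1 - l) ^ (2 * n)" using n by linarith
    then have big: "l * (1 - l) ^ (2 * n) < - 1" using l by (simp add: field_simps)
    define P :: "complex poly" where "P = [:0, 1:] * [:1, - 1:] ^ (2 * n)"
    have polyP: "poly P (of_real t) = of_real (t * (1 - t) ^ (2 * n))" for t
      by (simp add: P_def)
    have degP: "0 < degree P"
      by (simp add: P_def degree_mult_eq degree_power_eq)
    define c where "c = b * (1 - h) ^ n"
    have comm: "(1 - h) ^ n * h = h * (1 - h) ^ n"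
      by (rule power_commuting_commutes) (simp add: algebra_simps)
    have "star c * c = (1 - h) ^ n * h * (1 - h) ^ n"
      by (simp add: c_def star_mult star_power star_diff sa mult.assoc h_def star_star)
    also have "\<dots> = h * (1 - h) ^ (2 * n)" unfolding comm by (simp add: mult.assoc power_add[symmetric] mult_2)
    also have "\<dots> = poly_calculus P h"
      by (simp add: P_def poly_calculus_mult poly_calculus_power)
    finally have cc: "star c * c = poly_calculus P h" .
    have le1: "Re w \<le> 1" if w: "w \<in> spectrum (star c * c)" for w
    proof -
      obtain u where u: "u \<in> spectrum h" "w = poly P u"
        using spectrum_poly_calculus_subset[OF degP w[unfolded cc]] by blast
      obtain t where t: "u = of_real t"
        using selfadjoint_spectrum_Reals[OF sa u(1)] by (auto elim: Reals_cases)
      have "\<bar>t\<bar> \<le> 1" using spectrum_norm_le[OF u(1)] nh t by simp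
      have "t * (1 - t) ^ (2 * n) \<le> 1"
      proof (cases "0 \<le> t")
        case True
        then have "(1 - t) ^ (2 * n) \<le> 1" "0 \<le> (1 - t) ^ (2 * n)" using \<open>\<bar>t\<bar> \<le> 1\<close> by (auto intro: power_le_one)
        then show ?thesis using True \<open>\<bar>t\<bar> \<le> 1\<close> mult_le_one[of t] by auto
      next
        case False
        then have "t * (1 - t) ^ (2 * n) \<le> 0" by (intro mult_nonpos_nonneg) auto
        then show ?thesis by simp
      qed
      then show ?thesis using u t polyP[of t] by simp
    qed
    have le1': "Re w \<le> 1" if "w \<in> spectrum (c * star c)" for w
      using le1 spectrum_mult_swap[OF that] by (cases "w = 0") auto
    have pE: "positive_elem (1 *\<^sub>R 1 - c * star c)"
      by (subst positive_elem_scaleR_one_minus) (use le1' in \<open>auto simp: star_mult star_star\<close>)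
    define s where "s = c + star c"
    define t where "t = \<i> *\<^sub>C (c - star c)"
    have st: "star s = s" "star t = t"
      by (simp_all add: s_def t_def star_add star_diff star_star star_scaleC
          scaleC.scale_right_diff_distrib add.commute)
    have tt: "t * t = - ((c - star c) * (c - star c))"
      by (simp add: t_def mult_scaleC_left mult_scaleC_right scaleC_scaleC)
    have "s * s + t * t + 2 *\<^sub>R (1 *\<^sub>R 1 - c * star c) = 2 *\<^sub>R (1 *\<^sub>R 1 - (- (star c * c)))"
      unfolding tt s_def by (simp add: algebra_simps scaleR_2)
    then have "positive_elem (2 *\<^sub>R (1 *\<^sub>R 1 - (- (star c * c))))"
      using pE positive_elem_square[OF st(1)] positive_elem_square[OF st(2)]
      by (metis positive_elem_add positive_elem_scaleR zero_less_numeral)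
    then have pD: "positive_elem (1 *\<^sub>R 1 - (- (star c * c)))"
      by (subst (asm) positive_elem_scaleR) auto
    have "of_real (l * (1 - l) ^ (2 * n)) \<in> spectrum (star c * c)"
      using poly_in_spectrum_poly_calculus[OF z, of P] polyP[of l] by (simp only: cc l(1))
    then have "- of_real (l * (1 - l) ^ (2 * n)) \<in> spectrum (- (star c * c))"
      by (simp only: spectrum_minus minus_minus)
    then have "- (l * (1 - l) ^ (2 * n)) \<le> 1"
      using pD by (subst (asm) positive_elem_scaleR_one_minus) (fastforce simp: star_mult star_star)+
    then show False using big by simp
  qed
  then show ?thesis using sa by (simp add: positive_elem_iff_Re h_def)
qed

text \<open>The Fukamiya--Kaplansky theorem.\<close>
lemma positive_elem_star_mult: "positive_elem (star b * (b::'a::unital_cstar_algebra))"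
proof (cases "b = 0")
  case True
  then show ?thesis using positive_elem_star_mult_contraction[of b] by simp
next
  case False
  let ?r = "inverse (norm b)"
  have "positive_elem (star (?r *\<^sub>R b) * (?r *\<^sub>R b))"
    using False by (intro positive_elem_star_mult_contraction) simp
  then have "positive_elem ((?r * ?r) *\<^sub>R (star b * b))" by simp
  then show ?thesis using False by (subst (asm) positive_elem_scaleR) auto
qed

section \<open>Square roots of positive invertible elements\<close>

lemma positive_invertible_lower_bound:
  fixes a :: "'a::unital_cstar_algebra"
  assumes "positive_elem a" "invertible_elem a"
  shows "\<exists>c>0. positive_elem (a - c *\<^sub>R 1) \<and> (\<forall>z\<in>spectrum a. c \<le> Re z)"
proof -
  obtain b where b: "a * b = 1" "b * a = 1" using assms(2) by (auto simp: invertible_elem_def)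
  have "b \<noteq> 0" using b by auto
  define c where "c = 1 / norm b"
  have c: "c > 0" using \<open>b \<noteq> 0\<close> by (simp add: c_def)
  have sa: "star a = a" using assms(1) by (rule positive_elem_star)
  have low: "c \<le> Re z" if z: "z \<in> spectrum a" for z
  proof (rule ccontr)
    assume neg: "\<not> c \<le> Re z"
    obtain x where x: "z = of_real x" using selfadjoint_spectrum_Reals[OF sa z] by (auto elim: Reals_cases)
    have "0 \<le> x" using assms(1) z x by (auto simp: positive_elem_iff_Re[OF sa])
    then have "cmod z * norm b < 1" using neg x \<open>b \<noteq> 0\<close> by (simp add: c_def field_simps)
    then have "invertible_elem (1 - z *\<^sub>C b)" by (intro invertible_one_minus) (simp add: norm_scaleC)
    then have "invertible_elem (a * (1 - z *\<^sub>C b))" using assms(2) by (intro invertible_elem_mult)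
    then show False using z b by (simp add: spectrum_def algebra_simps mult_scaleC_right)
  qed
  have "0 \<le> Re z" if "z \<in> spectrum (a - of_real c *\<^sub>C 1)" for z
    using that low[of "z + of_real c"] unfolding spectrum_diff_scaleC_one by simp
  then have "positive_elem (a - c *\<^sub>R 1)"
    using sa by (simp add: positive_elem_iff_Re star_diff scaleC_of_real)
  then show ?thesis using c low by blast
qed

text \<open>\<open>(1 - y)\<^sup>2 = 1 - k\<close> holds iff \<open>y\<close> is a fixed point of \<open>y \<mapsto> (k + y\<^sup>2) / 2\<close>, which is a
  contraction of the self-adjoint part of the ball of radius \<open>norm k\<close>.\<close>
lemma selfadjoint_sqrt_one_minus:
  fixes k :: "'a::unital_cstar_algebra"
  assumes sa: "star k = k" and k: "norm k < 1"
  shows "\<exists>b. star b = b \<and> b * b = 1 - k"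
proof -
  define s where "s = norm k"
  define S where "S = {y::'a. norm y \<le> s \<and> star y = y}"
  define T where "T y = (1/2) *\<^sub>R (k + y * y)" for y
  have "closed S" unfolding S_def
    by (intro closed_Collect_conj closed_Collect_le closed_Collect_eq continuous_intros continuous_on_star)
  then have "complete S" by (simp add: complete_eq_closed)
  moreover have "S \<noteq> {}" by (auto simp: S_def s_def intro!: exI[of _ 0])
  moreover have "0 \<le> s" "s < 1" using k by (auto simp: s_def)
  moreover have "T ` S \<subseteq> S"
  proof
    fix z assume "z \<in> T ` S"
    then obtain y where y: "norm y \<le> s" "star y = y" "z = T y" by (auto simp: S_def)
    have "norm y * norm y \<le> s * 1" using y \<open>s < 1\<close> norm_ge_zero[of y] by (intro mult_mono) linarith+
    then have "norm (y * y) \<le> s" using norm_mult_ineq[of y y] by linarith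
    then have "norm (k + y * y) \<le> 2 * s"
      using norm_triangle_ineq[of k "y * y"] by (simp add: s_def)
    then show "z \<in> S" using y sa by (simp add: S_def T_def star_add star_mult)
  qed
  moreover have "dist (T x) (T y) \<le> s * dist x y" if "x \<in> S" "y \<in> S" for x y
  proof -
    have "T x - T y = (1/2) *\<^sub>R (x * (x - y) + (x - y) * y)"
      by (simp add: T_def algebra_simps)
    then have "norm (T x - T y) = norm (x * (x - y) + (x - y) * y) / 2"
      by (simp only: norm_scaleR)
    also have "norm (x * (x - y) + (x - y) * y) \<le> norm x * norm (x - y) + norm (x - y) * norm y"
      by (meson norm_triangle_mono norm_mult_ineq)
    also have "\<dots> \<le> s * norm (x - y) + norm (x - y) * s"
      using that by (intro add_mono mult_left_mono mult_right_mono) (auto simp: S_def)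
    finally show ?thesis by (simp add: dist_norm mult.commute)
  qed
  ultimately obtain y where y: "y \<in> S" "T y = y" using Banach_fix[of S s T] by blast
  have "2 *\<^sub>R y = k + y * y"
    using arg_cong[OF y(2), of "\<lambda>v. 2 *\<^sub>R v"] by (simp add: T_def)
  then have "(1 - y) * (1 - y) = 1 - k" by (simp add: algebra_simps scaleR_2)
  moreover have "star (1 - y) = 1 - y" using y by (simp add: S_def star_diff)
  ultimately show ?thesis by blast
qed

lemma positive_invertible_sqrt:
  fixes a :: "'a::unital_cstar_algebra"
  assumes "positive_elem a" "invertible_elem a"
  shows "\<exists>b. star b = b \<and> b * b = a"
proof -
  have sa: "star a = a" using assms(1) by (rule positive_elem_star)
  obtain c where c: "c > 0" "\<And>z. z \<in> spectrum a \<Longrightarrow> c \<le> Re z"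
    using positive_invertible_lower_bound[OF assms] by blast
  define M where "M = norm a"
  have "a \<noteq> 0" using assms(2) by (auto simp: invertible_elem_def)
  then have M: "M > 0" by (simp add: M_def)
  \<comment> \<open>The spectrum of \<open>a\<close> lies in \<open>[c, M]\<close>, so that of \<open>k = 1 - a / M\<close> lies in \<open>[0, 1 - c / M]\<close>.\<close>
  define k where "k = 1 *\<^sub>R 1 - of_real (1 / M) *\<^sub>C a"
  have sk: "star k = k" using sa by (simp add: k_def star_diff star_scaleC)
  have "norm k \<le> max 0 (1 - c / M)"
  proof (rule selfadjoint_norm_le_spectral_radius[OF sk])
    fix z assume z: "z \<in> spectrum k"
    obtain x where x: "z = of_real x" using selfadjoint_spectrum_Reals[OF sk z] by (auto elim: Reals_cases)
    have "of_real 1 - z \<in> spectrum (of_real (1 / M) *\<^sub>C a)"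
      using z unfolding k_def spectrum_scaleR_one_minus .
    then have "(1 - z) / of_real (1 / M) \<in> spectrum a"
      using M by (subst (asm) spectrum_scaleC) auto
    then have w: "of_real ((1 - x) * M) \<in> spectrum a" by (simp add: x)
    have "c \<le> (1 - x) * M" using c(2)[OF w] by simp
    then have "x \<le> 1 - c / M" using M by (simp add: field_simps)
    moreover have "(1 - x) * M \<le> M"
      using order_trans[OF complex_Re_le_cmod spectrum_norm_le[OF w]] by (simp add: M_def)
    then have "0 \<le> x" using M by simp
    ultimately show "cmod z \<le> max 0 (1 - c / M)" using x by simp
  qed simp
  moreover have "max 0 (1 - c / M) < 1" using c(1) M by simp
  ultimately have "norm k < 1" by linarith
  then obtain b where b: "star b = b" "b * b = 1 - k" using selfadjoint_sqrt_one_minus[OF sk] by blast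
  have "1 - k = (1 / M) *\<^sub>R a" by (simp only: k_def scaleC_of_real) simp
  then have "(sqrt M *\<^sub>R b) * (sqrt M *\<^sub>R b) = a" using M b by simp
  then show ?thesis using b(1) by (intro exI[of _ "sqrt M *\<^sub>R b"]) simp
qed

lemma positive_elem_conjugate:
  fixes a x :: "'a::unital_cstar_algebra"
  assumes "positive_elem a" "invertible_elem a"
  shows "positive_elem (star x * a * x)"
proof -
  obtain b where b: "star b = b" "b * b = a" using positive_invertible_sqrt[OF assms] by blast
  then have "star x * a * x = star (b * x) * (b * x)"
    by (simp add: star_mult mult.assoc flip: b(2))
  then show ?thesis by (simp add: positive_elem_star_mult)
qed

section \<open>Sublinear functionals and the Hahn--Banach theorem\<close>

text \<open>Sublinear functionals on a real vector space. Homogeneity is required only as an inequality and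
  for positive scalars; equality and the value 0 at the origin follow.\<close>
definition sublinear :: "('a::real_vector \<Rightarrow> real) \<Rightarrow> bool" where
  "sublinear p \<longleftrightarrow> (\<forall>x y. p (x + y) \<le> p x + p y) \<and> (\<forall>r>0. \<forall>x. p (r *\<^sub>R x) \<le> r * p x)"

lemma sublinear_add: "sublinear p \<Longrightarrow> p (x + y) \<le> p x + p y"
  by (simp add: sublinear_def)

lemma sublinear_scaleR:
  assumes "sublinear p" "0 < r"
  shows "p (r *\<^sub>R x) = r * p x"
proof -
  have "p (inverse r *\<^sub>R r *\<^sub>R x) \<le> inverse r * p (r *\<^sub>R x)"
    using assms unfolding sublinear_def by (meson positive_imp_inverse_positive)
  then have "r * p x \<le> p (r *\<^sub>R x)" using assms(2) by (simp add: field_simps)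
  moreover have "p (r *\<^sub>R x) \<le> r * p x" using assms by (simp add: sublinear_def)
  ultimately show ?thesis by simp
qed

lemma sublinear_zero: "sublinear p \<Longrightarrow> p 0 = 0"
  using sublinear_scaleR[of p 2 0] by simp

lemma sublinear_minus: "sublinear p \<Longrightarrow> - p (- x) \<le> p x"
  using sublinear_add[of p x "- x"] sublinear_zero[of p] by simp

text \<open>Pointwise infima of sublinear functionals are rarely sublinear; the two conditions on the family
  hold for chains and for the perturbations used in the next lemma.\<close>
lemma sublinear_INF:
  fixes F :: "'i \<Rightarrow> 'a::real_vector \<Rightarrow> real"
  assumes I: "I \<noteq> {}" and bdd: "\<And>x. bdd_below ((\<lambda>i. F i x) ` I)"
    and add: "\<And>i j x y. i \<in> I \<Longrightarrow> j \<in> I \<Longrightarrow> \<exists>k\<in>I. F k (x + y) \<le> F i x + F j y"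
    and scale: "\<And>i r x. i \<in> I \<Longrightarrow> 0 < r \<Longrightarrow> \<exists>k\<in>I. F k (r *\<^sub>R x) \<le> r * F i x"
  shows "sublinear (\<lambda>x. INF i\<in>I. F i x)"
  unfolding sublinear_def
proof (intro conjI allI impI)
  fix x y
  let ?u = "\<lambda>x. INF i\<in>I. F i x"
  have le: "?u (x + y) \<le> F i x + F j y" if ij: "i \<in> I" "j \<in> I" for i j
  proof -
    obtain k where k: "k \<in> I" "F k (x + y) \<le> F i x + F j y" using add[OF ij] by blast
    show ?thesis using cINF_lower[OF bdd k(1)] k(2) by (rule order_trans)
  qed
  have "?u (x + y) - F i x \<le> ?u y" if "i \<in> I" for i
    using le[OF that] by (intro cINF_greatest I) (simp add: algebra_simps)
  then have "?u (x + y) - ?u y \<le> ?u x"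
    by (intro cINF_greatest I) (simp add: algebra_simps)
  then show "?u (x + y) \<le> ?u x + ?u y" by simp
next
  fix r :: real and x assume r: "0 < r"
  let ?u = "\<lambda>x. INF i\<in>I. F i x"
  have "?u (r *\<^sub>R x) / r \<le> F i x" if i: "i \<in> I" for i
  proof -
    obtain k where k: "k \<in> I" "F k (r *\<^sub>R x) \<le> r * F i x" using scale[OF i r] by blast
    then show ?thesis using cINF_lower[OF bdd k(1), of "r *\<^sub>R x"] r by (simp add: field_simps)
  qed
  then have "?u (r *\<^sub>R x) / r \<le> ?u x" by (intro cINF_greatest I) auto
  then show "?u (r *\<^sub>R x) \<le> r * ?u x" using r by (simp add: field_simps)
qed

text \<open>The infimum over \<open>t \<ge> 0\<close> of \<open>p (x + t y) - t p y\<close> is a sublinear functional below \<open>p\<close> that is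
  as small as possible at \<open>- y\<close>. A minimal sublinear functional therefore satisfies
  \<open>p (- y) = - p y\<close> for all \<open>y\<close>, which makes it linear.\<close>
lemma sublinear_lower_direction:
  fixes p :: "'a::real_vector \<Rightarrow> real"
  assumes p: "sublinear p"
  shows "\<exists>q. sublinear q \<and> (\<forall>x. q x \<le> p x) \<and> q (- y) \<le> - p y"
proof -
  let ?F = "\<lambda>t x. p (x + t *\<^sub>R y) - t * p y"
  let ?q = "\<lambda>x. INF t\<in>{0..}. ?F t x"
  have ty: "p (t *\<^sub>R y) = t * p y" if "0 \<le> t" for t
    using that sublinear_scaleR[OF p, of t y] sublinear_zero[OF p] by (cases "t = 0") auto
  have bdd: "bdd_below ((\<lambda>t. ?F t x) ` {0..})" for x
  proof (rule bdd_belowI2)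
    fix t :: real assume "t \<in> {0..}"
    then show "- p (- x) \<le> ?F t x"
      using sublinear_add[OF p, of "x + t *\<^sub>R y" "- x"] ty[of t] by simp
  qed
  have "sublinear ?q"
  proof (rule sublinear_INF[OF _ bdd])
    fix s t :: real and u v :: 'a assume st: "s \<in> {0..}" "t \<in> {0..}"
    have "p ((u + s *\<^sub>R y) + (v + t *\<^sub>R y)) \<le> p (u + s *\<^sub>R y) + p (v + t *\<^sub>R y)" by (rule sublinear_add[OF p])
    then show "\<exists>k\<in>{0..}. ?F k (u + v) \<le> ?F s u + ?F t v"
      using st by (intro bexI[of _ "s + t"]) (auto simp: algebra_simps)
  next
    fix t r :: real and u :: 'a assume t: "t \<in> {0..}" and r: "0 < r"
    have "p (r *\<^sub>R (u + t *\<^sub>R y)) = r * p (u + t *\<^sub>R y)" by (rule sublinear_scaleR[OF p r])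
    then show "\<exists>k\<in>{0..}. ?F k (r *\<^sub>R u) \<le> r * ?F t u"
      using t r by (intro bexI[of _ "r * t"]) (auto simp: algebra_simps)
  qed auto
  moreover have "?q x \<le> p x" for x using cINF_lower[OF bdd[of x], of 0] by simp
  moreover have "?q (- y) \<le> - p y" using cINF_lower[OF bdd[of "- y"], of 1] sublinear_zero[OF p] by simp
  ultimately show ?thesis by blast
qed

lemma sublinear_chain_lower_bound:
  fixes p :: "'a::real_vector \<Rightarrow> real"
  assumes C: "C \<noteq> {}" "\<And>q. q \<in> C \<Longrightarrow> sublinear q" "\<And>q x. q \<in> C \<Longrightarrow> q x \<le> p x"
    and chain: "\<And>q r. q \<in> C \<Longrightarrow> r \<in> C \<Longrightarrow> q \<le> r \<or> r \<le> q"
  shows "\<exists>u. sublinear u \<and> (\<forall>q\<in>C. \<forall>x. u x \<le> q x)"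
proof -
  let ?u = "\<lambda>x. INF q\<in>C. q x"
  have bdd: "bdd_below ((\<lambda>q. q x) ` C)" for x
  proof (rule bdd_belowI2)
    fix q assume q: "q \<in> C"
    then show "- p (- x) \<le> q x" using sublinear_minus[OF C(2)[OF q], of x] C(3)[OF q, of "- x"] by linarith
  qed
  have "sublinear ?u"
  proof (rule sublinear_INF[OF C(1) bdd])
    fix q r x y assume qr: "q \<in> C" "r \<in> C"
    from chain[OF qr] show "\<exists>k\<in>C. k (x + y) \<le> q x + r y"
    proof
      assume "q \<le> r"
      then show ?thesis using sublinear_add[OF C(2)[OF qr(1)], of x y] qr
        by (intro bexI[of _ q]) (auto intro: order_trans simp: le_fun_def)
    next
      assume "r \<le> q"
      then show ?thesis using sublinear_add[OF C(2)[OF qr(2)], of x y] qr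
        by (intro bexI[of _ r]) (auto intro: order_trans simp: le_fun_def)
    qed
  next
    fix q :: "'a \<Rightarrow> real" and r :: real and x assume "q \<in> C" "0 < r"
    then show "\<exists>k\<in>C. k (r *\<^sub>R x) \<le> r * q x" using sublinear_scaleR[OF C(2), of q r x]
      by (intro bexI[of _ q]) auto
  qed
  moreover have "?u x \<le> q x" if "q \<in> C" for q x using cINF_lower[OF bdd that] by simp
  ultimately show ?thesis by blast
qed

text \<open>A sublinear functional dominates a linear one that agrees with it at a given point \<open>y\<close>: take a
  minimal sublinear functional below the one adapted to \<open>y\<close>.\<close>
lemma Hahn_Banach_sublinear:
  fixes p :: "'a::real_vector \<Rightarrow> real"
  assumes p: "sublinear p"
  shows "\<exists>f. linear f \<and> (\<forall>x. f x \<le> p x) \<and> f y = p y"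
proof -
  obtain p' where p': "sublinear p'" "\<And>x. p' x \<le> p x" "p' (- y) \<le> - p y"
    using sublinear_lower_direction[OF p] by blast
  define A where "A = {q. sublinear q \<and> q \<le> p'}"
  have "\<exists>m\<in>A. \<forall>q\<in>A. q \<le> m \<longrightarrow> q = m"
  proof (rule predicate_Zorn)
    show "partial_order_on A (relation_of (\<lambda>q r. r \<le> q) A)"
      by (auto simp: partial_order_on_def preorder_on_def relation_of_def refl_on_def
          intro!: transI antisymI)
    fix C assume C: "C \<in> Chains (relation_of (\<lambda>q r. r \<le> q) A)"
    then have CA: "C \<subseteq> A" and chain: "\<And>q r. q \<in> C \<Longrightarrow> r \<in> C \<Longrightarrow> q \<le> r \<or> r \<le> q"
      by (auto simp: Chains_def relation_of_def)
    show "\<exists>u\<in>A. \<forall>q\<in>C. u \<le> q"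
    proof (cases "C = {}")
      case True
      then show ?thesis using p' by (auto simp: A_def)
    next
      case False
      then obtain u where u: "sublinear u" "\<forall>q\<in>C. \<forall>x. u x \<le> q x"
        using sublinear_chain_lower_bound[of C p'] CA chain by (auto simp: A_def le_fun_def)
      obtain q where "q \<in> C" using False by blast
      then have "u \<le> p'" using u(2) CA by (auto simp: A_def le_fun_def intro: order_trans)
      then show ?thesis using u by (auto simp: A_def le_fun_def)
    qed
  qed
  then obtain f where f: "sublinear f" "f \<le> p'" and min: "\<And>q. sublinear q \<Longrightarrow> q \<le> f \<Longrightarrow> q = f"
    by (auto simp: A_def intro: order_trans)
  have minus: "f (- x) = - f x" for x
  proof -
    obtain q where q: "sublinear q" "\<And>v. q v \<le> f v" "q (- x) \<le> - f x"
      using sublinear_lower_direction[OF f(1)] by blast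
    then have "q = f" by (intro min) (auto simp: le_fun_def)
    then show ?thesis using q(3) sublinear_minus[OF f(1), of x] by simp
  qed
  have "linear f"
  proof (rule linearI)
    fix u v
    show "f (u + v) = f u + f v"
      using sublinear_add[OF f(1), of u v] sublinear_add[OF f(1), of "- u" "- v"]
        minus[of "u + v"] by (simp add: minus)
    fix r :: real
    show "f (r *\<^sub>R u) = r *\<^sub>R f u"
      using sublinear_scaleR[OF f(1), of r u] sublinear_scaleR[OF f(1), of "- r" u]
        sublinear_zero[OF f(1)] minus[of "r *\<^sub>R u"]
      by (cases r "0::real" rule: linorder_cases) auto
  qed
  moreover have "f x \<le> p x" for x using f(2) p'(2)[of x] by (auto simp: le_fun_def intro: order_trans)
  moreover have "p y \<le> f y" using minus[of y] f(2) p'(3) by (auto simp: le_fun_def dest!: spec[of _ "- y"])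
  ultimately show ?thesis by (meson order_antisym)
qed

section \<open>Positive functionals and \<open>a\<close>-states\<close>

text \<open>A real linear \<open>f\<close> with \<open>f \<le> norm\<close> and \<open>f 1 = 1\<close> is complexified as \<open>\<phi> x = f x - \<i> f (\<i> x)\<close>. The
  norm bounds on \<open>h + \<i>n\<close> and on \<open>norm h - h\<close> force \<open>\<phi>\<close> to be real on self-adjoint and nonnegative on
  positive elements.\<close>
lemma exists_state:
  "\<exists>\<phi>\<in>topological_dual. positive_functional \<phi> \<and> \<phi> (1::'a::unital_cstar_algebra) = 1"
proof -
  have "sublinear (norm :: 'a \<Rightarrow> real)"
    by (auto simp: sublinear_def norm_triangle_ineq)
  then obtain f :: "'a \<Rightarrow> real" where f: "linear f" "\<And>x. f x \<le> norm x" "f 1 = 1"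
    using Hahn_Banach_sublinear[of "norm :: 'a \<Rightarrow> real" 1] by auto
  note lin = linear_add[OF f(1)] linear_diff[OF f(1)] linear_neg[OF f(1)] linear_cmul[OF f(1)]
  have im_le: "f (\<i> *\<^sub>C h) \<le> 0" if sa: "star h = h" for h
  proof (rule ccontr)
    let ?g = "f (\<i> *\<^sub>C h)"
    assume "\<not> ?g \<le> 0"
    then have g: "?g > 0" by simp
    \<comment> \<open>With this \<open>n\<close>, \<open>(?g + n)\<^sup>2\<close> exceeds \<open>(norm h)\<^sup>2 + n\<^sup>2\<close>.\<close>
    define n where "n = (norm h)\<^sup>2 / ?g"
    have n: "n \<ge> 0" using g by (simp add: n_def)
    have "\<i> *\<^sub>C (h + (\<i> * of_real (- n)) *\<^sub>C 1) = \<i> *\<^sub>C h + of_real n *\<^sub>C 1"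
      by (simp add: scaleC_add_right scaleC_scaleC scaleC.scale_right_diff_distrib mult.assoc[symmetric])
    then have "?g + n \<le> norm (\<i> *\<^sub>C (h + (\<i> * of_real (- n)) *\<^sub>C 1))"
      using f(2)[of "\<i> *\<^sub>C h + n *\<^sub>R 1"] by (simp add: lin f(3) scaleC_of_real)
    then have "?g + n \<le> norm (h + (\<i> * of_real (- n)) *\<^sub>C 1)" by (simp only: norm_scaleC) simp
    then have "(?g + n)\<^sup>2 \<le> (norm (h + (\<i> * of_real (- n)) *\<^sub>C 1))\<^sup>2"
      using g n by (intro power_mono) auto
    also have "\<dots> \<le> (norm h)\<^sup>2 + n\<^sup>2" using norm_selfadjoint_plus_imaginary[OF sa, of "- n"] by simp
    finally have "?g * ?g + 2 * (?g * n) \<le> (norm h)\<^sup>2" by (simp add: power2_eq_square algebra_simps)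
    moreover have "?g * n = (norm h)\<^sup>2" using g by (simp add: n_def)
    moreover have "?g * ?g > 0" using g by simp
    ultimately show False using zero_le_power2[of "norm h"] by linarith
  qed
  have im: "f (\<i> *\<^sub>C h) = 0" if "star h = h" for h
    using im_le[OF that] im_le[of "- h"] that by (simp add: lin)
  define \<phi> where "\<phi> x = Complex (f x) (- f (\<i> *\<^sub>C x))" for x
  have scale: "f (c *\<^sub>C x) = Re c * f x + Im c * f (\<i> *\<^sub>C x)" for c x
  proof -
    have "c *\<^sub>C x = Re c *\<^sub>R x + Im c *\<^sub>R (\<i> *\<^sub>C x)"
      by (simp add: scaleC_of_real[symmetric] scaleC_scaleC scaleC_add_left[symmetric] complex_eq_iff)
    then show ?thesis by (simp add: lin)
  qed
  have add: "\<phi> (x + y) = \<phi> x + \<phi> y" for x y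
    by (simp add: \<phi>_def scaleC_add_right lin complex_eq_iff)
  have scaleC: "\<phi> (c *\<^sub>C x) = c * \<phi> x" for c x
    using scale[of c x] scale[of "\<i> * c" x]
    by (simp add: \<phi>_def complex_eq_iff scaleC_scaleC)
  have "bounded_linear f"
    using f(2) f(2)[of "- _"]
    by (intro bounded_linear_intro[where K = 1]) (auto simp: lin abs_le_iff)
  moreover have "bounded_linear (\<lambda>x::'a. \<i> *\<^sub>C x)"
    by (intro bounded_linear_intro[where K = 1])
       (auto simp: scaleC_add_right scaleC_scaleR norm_scaleC)
  ultimately have "continuous_on UNIV \<phi>"
    unfolding \<phi>_def[abs_def] Complex_eq
    by (intro continuous_intros bounded_linear.continuous_on[of f]
        bounded_linear.continuous_on[of "\<lambda>x. \<i> *\<^sub>C x"])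
  then have "\<phi> \<in> topological_dual" using add scaleC by (simp add: topological_dual_def)
  moreover have "positive_functional \<phi>"
    unfolding positive_functional_def
  proof (intro allI impI)
    fix h :: 'a assume h: "positive_elem h"
    then have sa: "star h = h" by (rule positive_elem_star)
    have "norm (norm h *\<^sub>R 1 - h) \<le> norm h" using h positive_elem_iff_norm[OF sa] by simp
    then have "norm h - f h \<le> norm h" using f(2)[of "norm h *\<^sub>R 1 - h"] by (simp add: lin f(3))
    then show "\<phi> h \<in> \<real>\<^sub>\<ge>\<^sub>0" using im[OF sa] by (simp add: \<phi>_def complex_nonneg_Reals_iff)
  qed
  moreover have "\<phi> 1 = 1" using im[of 1] f(3) by (simp add: \<phi>_def complex_eq_iff)
  ultimately show ?thesis by blast
qed

text \<open>Continuous positive functionals, with no normalisation.\<close>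
locale positive_dual =
  fixes \<phi> :: "'a::unital_cstar_algebra \<Rightarrow> complex"
  assumes dual: "\<phi> \<in> topological_dual" and positive: "positive_functional \<phi>"
begin

lemma add: "\<phi> (x + y) = \<phi> x + \<phi> y"
  and scaleC: "\<phi> (c *\<^sub>C x) = c * \<phi> x"
  using dual by (auto simp: topological_dual_def)

lemma scaleR: "\<phi> (r *\<^sub>R x) = of_real r * \<phi> x"
  by (metis scaleC scaleC_of_real)

lemma minus: "\<phi> (- x) = - \<phi> x"
  using scaleR[of "-1" x] by simp

lemma diff: "\<phi> (x - y) = \<phi> x - \<phi> y"
  using add[of x "- y"] minus[of y] by simp

lemma nonneg: "positive_elem p \<Longrightarrow> 0 \<le> Re (\<phi> p) \<and> Im (\<phi> p) = 0"
  using positive by (auto simp: positive_functional_def complex_nonneg_Reals_iff)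

lemma nonneg_one: "0 \<le> Re (\<phi> 1) \<and> Im (\<phi> 1) = 0"
  using nonneg[OF positive_elem_square[of 1]] by simp

lemma selfadjoint:
  assumes "star h = h"
  shows "Im (\<phi> h) = 0" "\<bar>Re (\<phi> h)\<bar> \<le> norm h * Re (\<phi> 1)"
  using nonneg[OF positive_elem_norm_minus[of h "norm h"]]
    nonneg[OF positive_elem_norm_minus[of "- h" "norm h"]] assms nonneg_one
  by (auto simp: diff add scaleR)

lemma star: "\<phi> (star x) = cnj (\<phi> x)"
proof -
  have "Im (\<phi> (x + star x)) = 0" by (rule selfadjoint) (simp add: star_add star_star add.commute)
  moreover have "Im (\<phi> (\<i> *\<^sub>C (x - star x))) = 0"
    by (rule selfadjoint) (simp add: star_scaleC star_diff star_star scaleC.scale_right_diff_distrib)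
  ultimately show ?thesis by (simp add: add diff scaleC complex_eq_iff)
qed

text \<open>The optimal constant is \<open>Re (\<phi> 1)\<close>; the factor 2 from splitting into real and imaginary parts
  is harmless, as only boundedness matters.\<close>
lemma norm_le: "cmod (\<phi> x) \<le> 2 * Re (\<phi> 1) * norm x"
proof -
  define s where "s = x + star x"
  define t where "t = \<i> *\<^sub>C (x - star x)"
  have st: "star s = s" "star t = t"
    by (simp_all add: s_def t_def star_add star_diff star_star star_scaleC
        scaleC.scale_right_diff_distrib add.commute)
  have n: "norm s \<le> 2 * norm x" "norm t \<le> 2 * norm x"
    using norm_triangle_ineq[of x "star x"] norm_triangle_ineq4[of x "star x"]
    by (simp_all add: s_def t_def norm_scaleC)
  have "cmod (\<phi> v) \<le> 2 * norm x * Re (\<phi> 1)" if "star v = v" "norm v \<le> 2 * norm x" for v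
  proof -
    have "cmod (\<phi> v) = \<bar>Re (\<phi> v)\<bar>" using selfadjoint(1)[OF that(1)] by (simp add: cmod_eq_Re)
    also have "\<dots> \<le> norm v * Re (\<phi> 1)" by (rule selfadjoint(2)[OF that(1)])
    also have "\<dots> \<le> 2 * norm x * Re (\<phi> 1)" using that(2) nonneg_one by (intro mult_right_mono) auto
    finally show ?thesis .
  qed
  note b = this[OF st(1) n(1)] this[OF st(2) n(2)]
  have "2 * \<phi> x = \<phi> s - \<i> * \<phi> t" by (simp add: s_def t_def add diff scaleC algebra_simps)
  then have "cmod (2 * \<phi> x) \<le> cmod (\<phi> s) + cmod (\<i> * \<phi> t)" by (metis norm_triangle_ineq4)
  then have "2 * cmod (\<phi> x) \<le> cmod (\<phi> s) + cmod (\<phi> t)" by (simp add: norm_mult)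
  then show ?thesis using b by (simp add: algebra_simps)
qed

end

lemma positive_dual_a_states: "\<phi> \<in> a_states a \<Longrightarrow> positive_dual \<phi>"
  by (simp add: a_states_def positive_dual_def)

lemma a_states_nonempty:
  fixes a :: "'a::unital_cstar_algebra"
  assumes "positive_elem a" "invertible_elem a"
  shows "a_states a \<noteq> {}"
proof -
  obtain \<psi> :: "'a \<Rightarrow> complex" where \<psi>: "\<psi> \<in> topological_dual" "positive_functional \<psi>" "\<psi> 1 = 1"
    using exists_state by blast
  interpret positive_dual \<psi> using \<psi> by unfold_locales
  obtain c where c: "c > 0" "positive_elem (a - c *\<^sub>R 1)"
    using positive_invertible_lower_bound[OF assms] by blast
  define r where "r = Re (\<psi> a)"
  have r: "\<psi> a = of_real r" "r > 0"
    using nonneg[OF c(2)] nonneg[OF assms(1)] c(1) \<psi>(3)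
    by (auto simp: diff scaleR r_def complex_eq_iff)
  define \<phi> where "\<phi> x = of_real (inverse r) * \<psi> x" for x
  have "positive_functional \<phi>"
    using nonneg r(2) by (auto simp: positive_functional_def \<phi>_def complex_nonneg_Reals_iff)
  moreover have "\<phi> \<in> topological_dual"
    using \<psi>(1) unfolding topological_dual_def \<phi>_def
    by (auto simp: algebra_simps intro: continuous_on_mult_right)
  ultimately have "\<phi> \<in> a_states a" using r by (simp add: a_states_def \<phi>_def)
  then show ?thesis by blast
qed

lemma a_states_bounded:
  fixes a :: "'a::unital_cstar_algebra"
  assumes "positive_elem a" "invertible_elem a"
  shows "\<exists>K. \<forall>\<phi>\<in>a_states a. \<forall>x. cmod (\<phi> x) \<le> K * norm x"
proof -
  obtain c where c: "c > 0" "positive_elem (a - c *\<^sub>R 1)"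
    using positive_invertible_lower_bound[OF assms] by blast
  have "cmod (\<phi> x) \<le> 2 / c * norm x" if \<phi>: "\<phi> \<in> a_states a" for \<phi> x
  proof -
    interpret positive_dual \<phi> by (rule positive_dual_a_states[OF \<phi>])
    have "\<phi> a = 1" using \<phi> by (simp add: a_states_def)
    then have "Re (\<phi> 1) \<le> 1 / c" using nonneg[OF c(2)] c(1) by (simp add: diff scaleR field_simps)
    then have "2 * Re (\<phi> 1) * norm x \<le> 2 * (1 / c) * norm x" by (intro mult_right_mono mult_left_mono) auto
    then show ?thesis using norm_le[of x] by simp
  qed
  then show ?thesis by blast
qed

text \<open>The Banach--Alaoglu argument: in the topology of pointwise convergence, the \<open>a\<close>-states are
  a closed subset of a product of discs. Continuity of the limits is automatic from the uniform
  bound.\<close>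
lemma compact_a_states:
  fixes a :: "'a::unital_cstar_algebra"
  assumes "positive_elem a" "invertible_elem a"
  shows "compact (a_states a)"
proof -
  obtain K where K: "\<And>\<phi> x. \<phi> \<in> a_states a \<Longrightarrow> cmod (\<phi> x) \<le> K * norm x"
    using a_states_bounded[OF assms] by blast
  define B :: "('a \<Rightarrow> complex) set" where "B = PiE UNIV (\<lambda>x. cball 0 (K * norm x))"
  have "compactin (product_topology (\<lambda>_. euclidean) UNIV) B"
    unfolding B_def compactin_PiE by simp
  then have B: "compact B" by (simp add: euclidean_product_topology)
  define L :: "('a \<Rightarrow> complex) set" where
    "L = {\<phi>. (\<forall>x y. \<phi> (x + y) = \<phi> x + \<phi> y) \<and> (\<forall>c x. \<phi> (c *\<^sub>C x) = c * \<phi> x) \<and> \<phi> a = 1}"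
  define P :: "('a \<Rightarrow> complex) set" where "P = (\<Inter>p\<in>Collect positive_elem. (\<lambda>\<phi>. \<phi> p) -` \<real>\<^sub>\<ge>\<^sub>0)"
  have "closed L" unfolding L_def
    by (intro closed_Collect_conj closed_Collect_all closed_Collect_eq continuous_intros
        continuous_on_product_coordinates)
  moreover have "closed P" unfolding P_def
    by (intro closed_INT ballI closed_vimage closed_nonneg_Reals_complex continuous_on_product_coordinates)
  moreover have "a_states a = B \<inter> L \<inter> P"
  proof (intro equalityI subsetI)
    fix \<phi> assume "\<phi> \<in> a_states a"
    then show "\<phi> \<in> B \<inter> L \<inter> P" using K[of \<phi>]
      by (auto simp: a_states_def B_def L_def P_def topological_dual_def positive_functional_def)
  next
    fix \<phi> assume \<phi>: "\<phi> \<in> B \<inter> L \<inter> P"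
    then have L: "\<phi> (x + y) = \<phi> x + \<phi> y" "\<phi> (c *\<^sub>C x) = c * \<phi> x" for x y c
      by (auto simp: L_def)
    have "bounded_linear \<phi>"
    proof (rule bounded_linear_intro[where K = K])
      show "\<phi> (r *\<^sub>R x) = r *\<^sub>R \<phi> x" for r x
        using L(2)[of "of_real r" x] by (simp add: scaleC_of_real scaleR_conv_of_real)
      show "norm (\<phi> x) \<le> norm x * K" for x
        using \<phi> by (auto simp: B_def PiE_def Pi_def mult.commute)
    qed (rule L)
    then have "continuous_on UNIV \<phi>" by (rule linear_continuous_on)
    then show "\<phi> \<in> a_states a" using \<phi>
      by (auto simp: a_states_def L_def P_def topological_dual_def positive_functional_def)
  qed
  ultimately show ?thesis using B by (simp add: compact_Int_closed)
qed

lemma compact_SUP_attained: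
  fixes f :: "'a::topological_space \<Rightarrow> real"
  assumes "compact S" "S \<noteq> {}" "continuous_on S f"
  shows "\<And>s. s \<in> S \<Longrightarrow> f s \<le> (SUP s\<in>S. f s)" "\<exists>s\<in>S. f s = (SUP s\<in>S. f s)"
proof -
  obtain m where m: "m \<in> S" "\<And>s. s \<in> S \<Longrightarrow> f s \<le> f m"
    using continuous_attains_sup[OF assms] by blast
  then have "(SUP s\<in>S. f s) = f m" by (intro cSup_eq_maximum) auto
  with m show "\<And>s. s \<in> S \<Longrightarrow> f s \<le> (SUP s\<in>S. f s)" "\<exists>s\<in>S. f s = (SUP s\<in>S. f s)" by auto
qed

section \<open>Attained suprema, the form \<open>\<phi> (star x * a * y)\<close>, and parallelism\<close>

lemma complex_eq_of_realI:
  assumes "cmod u \<le> r" "r \<le> Re u"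
  shows "u = of_real r"
proof -
  have "cmod u = r" "Re u = r" using assms complex_Re_le_cmod[of u] by linarith+
  then have "(Im u)\<^sup>2 = 0" using cmod_power2[of u] by simp
  then show ?thesis using \<open>Re u = r\<close> by (simp add: complex_eq_iff)
qed

lemma cmod_add_power2: "(cmod (u + v))\<^sup>2 = (cmod u)\<^sup>2 + (cmod v)\<^sup>2 + 2 * Re (cnj u * v)"
  by (simp add: cmod_power2) (simp add: power2_eq_square algebra_simps)

lemma a_numerical_radius_attained:
  fixes a x :: "'a::unital_cstar_algebra"
  assumes "positive_elem a" "invertible_elem a"
  shows "\<And>\<phi>. \<phi> \<in> a_states a \<Longrightarrow> cmod (\<phi> (a * x)) \<le> a_numerical_radius a x"
    and "\<exists>\<phi>\<in>a_states a. cmod (\<phi> (a * x)) = a_numerical_radius a x"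
proof -
  have "continuous_on UNIV (\<lambda>\<phi>. cmod (\<phi> (a * x)))"
    by (intro continuous_on_norm continuous_on_product_coordinates)
  then have "continuous_on (a_states a) (\<lambda>\<phi>. cmod (\<phi> (a * x)))"
    by (rule continuous_on_subset) simp
  note att = compact_SUP_attained[OF compact_a_states[OF assms] a_states_nonempty[OF assms] this]
  show "\<And>\<phi>. \<phi> \<in> a_states a \<Longrightarrow> cmod (\<phi> (a * x)) \<le> a_numerical_radius a x"
    and "\<exists>\<phi>\<in>a_states a. cmod (\<phi> (a * x)) = a_numerical_radius a x"
    using att unfolding a_numerical_radius_def by auto
qed

lemma a_norm_attained:
  fixes a x :: "'a::unital_cstar_algebra"
  assumes "positive_elem a" "invertible_elem a"
  shows "\<And>\<phi>. \<phi> \<in> a_states a \<Longrightarrow> sqrt (Re (\<phi> (star x * a * x))) \<le> a_norm a x"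
    and "\<exists>\<phi>\<in>a_states a. sqrt (Re (\<phi> (star x * a * x))) = a_norm a x"
proof -
  have "continuous_on UNIV (\<lambda>\<phi>. sqrt (Re (\<phi> (star x * a * x))))"
    by (intro continuous_on_real_sqrt continuous_on_Re continuous_on_product_coordinates)
  then have "continuous_on (a_states a) (\<lambda>\<phi>. sqrt (Re (\<phi> (star x * a * x))))"
    by (rule continuous_on_subset) simp
  note att = compact_SUP_attained[OF compact_a_states[OF assms] a_states_nonempty[OF assms] this]
  show "\<And>\<phi>. \<phi> \<in> a_states a \<Longrightarrow> sqrt (Re (\<phi> (star x * a * x))) \<le> a_norm a x"
    and "\<exists>\<phi>\<in>a_states a. sqrt (Re (\<phi> (star x * a * x))) = a_norm a x"
    using att unfolding a_norm_def by auto
qed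

lemma (in positive_dual) sesquilinear_form_add:
  assumes "star a = a"
  shows "Re (\<phi> (star (x + c *\<^sub>C y) * a * (x + c *\<^sub>C y)))
    = Re (\<phi> (star x * a * x)) + 2 * Re (c * \<phi> (star x * a * y)) + (cmod c)\<^sup>2 * Re (\<phi> (star y * a * y))"
proof -
  have "\<phi> (star y * a * x) = cnj (\<phi> (star x * a * y))"
    using star[of "star x * a * y"] assms by (simp add: star_mult star_star mult.assoc)
  then have "\<phi> (star (x + c *\<^sub>C y) * a * (x + c *\<^sub>C y)) =
      \<phi> (star x * a * x) + (c * \<phi> (star x * a * y) + cnj (c * \<phi> (star x * a * y)))
      + (c * cnj c) * \<phi> (star y * a * y)"
    by (simp add: star_add star_scaleC distrib_left distrib_right mult_scaleC_left mult_scaleC_right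
        add scaleC scaleC_scaleC algebra_simps)
  also have "c * cnj c = of_real ((cmod c)\<^sup>2)" by (rule complex_norm_square[symmetric])
  finally show ?thesis by simp
qed

lemma nonneg_quadratic_imp:
  fixes A m D :: real
  assumes q: "\<And>t. 0 \<le> A + 2 * t * m + t\<^sup>2 * D" and D: "0 \<le> D"
  shows "m\<^sup>2 \<le> A * D"
proof (cases "D = 0")
  case True
  have "m = 0"
  proof (rule ccontr)
    assume "m \<noteq> 0"
    then have "2 * (- (A + 1) / (2 * m)) * m = - (A + 1)" by simp
    then show False using q[of "- (A + 1) / (2 * m)"] True by simp
  qed
  then show ?thesis using True by simp
next
  case False
  then have "0 \<le> A - m\<^sup>2 / D" using q[of "- m / D"] by (simp add: power2_eq_square field_simps)
  then show ?thesis using False D by (simp add: field_simps)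
qed

text \<open>The form \<open>(x, y) \<mapsto> \<phi> (star x * a * y)\<close> is positive semidefinite, because
  \<open>star x * a * x\<close> is a positive element.\<close>
lemma (in positive_dual) Cauchy_Schwarz:
  assumes a: "positive_elem a" "invertible_elem a"
  shows "cmod (\<phi> (star x * a * y)) \<le> sqrt (Re (\<phi> (star x * a * x))) * sqrt (Re (\<phi> (star y * a * y)))"
proof -
  define \<beta> where "\<beta> = \<phi> (star x * a * y)"
  \<comment> \<open>The phase \<open>w\<close> makes the cross term real and nonnegative.\<close>
  define w where "w = (if \<beta> = 0 then 1 else cnj \<beta> / of_real (cmod \<beta>))"
  have w: "cmod w = 1" "w * \<beta> = of_real (cmod \<beta>)"
  proof -
    show "cmod w = 1" by (simp add: w_def norm_divide)
    have "cnj \<beta> * \<beta> = of_real (cmod \<beta>) * of_real (cmod \<beta>)"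
      by (metis complex_norm_square mult.commute of_real_power power2_eq_square)
    then show "w * \<beta> = of_real (cmod \<beta>)" by (simp add: w_def)
  qed
  have "(cmod \<beta>)\<^sup>2 \<le> Re (\<phi> (star x * a * x)) * Re (\<phi> (star y * a * y))"
  proof (rule nonneg_quadratic_imp)
    fix t :: real
    have e: "of_real t * w * \<phi> (star x * a * y) = of_real (t * cmod \<beta>)"
      using w(2) by (simp add: \<beta>_def mult.assoc)
    have "0 \<le> Re (\<phi> (star (x + (of_real t * w) *\<^sub>C y) * a * (x + (of_real t * w) *\<^sub>C y)))"
      using nonneg[OF positive_elem_conjugate[OF a]] by blast
    then show "0 \<le> Re (\<phi> (star x * a * x)) + 2 * t * cmod \<beta> + t\<^sup>2 * Re (\<phi> (star y * a * y))"
      unfolding sesquilinear_form_add[OF positive_elem_star[OF a(1)]] e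
      by (simp add: norm_mult w power_mult_distrib mult.assoc)
  next
    show "0 \<le> Re (\<phi> (star y * a * y))" using nonneg[OF positive_elem_conjugate[OF a]] by blast
  qed
  then have "sqrt ((cmod \<beta>)\<^sup>2) \<le> sqrt (Re (\<phi> (star x * a * x)) * Re (\<phi> (star y * a * y)))"
    by (rule real_sqrt_le_mono)
  then show ?thesis by (simp add: \<beta>_def real_sqrt_mult)
qed

lemma a_norm_nonneg:
  fixes a x :: "'a::unital_cstar_algebra"
  assumes "positive_elem a" "invertible_elem a"
  shows "0 \<le> a_norm a x"
proof -
  obtain \<phi> where \<phi>: "\<phi> \<in> a_states a" "sqrt (Re (\<phi> (star x * a * x))) = a_norm a x"
    using a_norm_attained(2)[OF assms] by blast
  interpret positive_dual \<phi> by (rule positive_dual_a_states[OF \<phi>(1)])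
  show ?thesis using nonneg[OF positive_elem_conjugate[OF assms, of x]] \<phi>(2)
    by (metis real_sqrt_ge_zero)
qed

lemma a_numerical_radius_parallel_iff:
  fixes a x y :: "'a::unital_cstar_algebra"
  assumes a: "positive_elem a" "invertible_elem a"
  shows "a_numerical_radius_parallel a x y \<longleftrightarrow>
           (\<exists>\<phi>\<in>a_states a. \<exists>\<mu>. cmod \<mu> = 1 \<and>
              cnj (\<phi> (a * x)) * \<phi> (a * y) =
                cnj \<mu> * of_real (a_numerical_radius a x) * of_real (a_numerical_radius a y))"
    (is "_ \<longleftrightarrow> ?R")
proof
  let ?V = "a_numerical_radius a x" and ?W = "a_numerical_radius a y"
  note le = a_numerical_radius_attained(1)[OF a] and att = a_numerical_radius_attained(2)[OF a]
  have add: "\<phi> (a * (x + \<mu> *\<^sub>C y)) = \<phi> (a * x) + \<mu> * \<phi> (a * y)" if "\<phi> \<in> a_states a" for \<phi> \<mu>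
  proof -
    interpret positive_dual \<phi> by (rule positive_dual_a_states[OF that])
    show ?thesis by (simp add: distrib_left mult_scaleC_right add scaleC)
  qed
  {
    assume "a_numerical_radius_parallel a x y"
    then obtain \<mu> where \<mu>: "cmod \<mu> = 1" "a_numerical_radius a (x + \<mu> *\<^sub>C y) = ?V + ?W"
      by (auto simp: a_numerical_radius_parallel_def)
    obtain \<phi> where \<phi>: "\<phi> \<in> a_states a" "cmod (\<phi> (a * (x + \<mu> *\<^sub>C y))) = ?V + ?W"
      using att[of "x + \<mu> *\<^sub>C y"] \<mu>(2) by auto
    define X Y where "X = \<phi> (a * x)" and "Y = \<mu> * \<phi> (a * y)"
    have n: "cmod X \<le> ?V" "cmod Y \<le> ?W" using le[OF \<phi>(1)] \<mu>(1) by (auto simp: X_def Y_def norm_mult)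
    have s: "cmod (X + Y) = ?V + ?W" using \<phi>(2) add[OF \<phi>(1)] by (simp add: X_def Y_def)
    have e: "cmod X = ?V" "cmod Y = ?W" using n s norm_triangle_ineq[of X Y] by linarith+
    have "cnj X * Y = of_real (?V * ?W)"
    proof (rule complex_eq_of_realI)
      show "cmod (cnj X * Y) \<le> ?V * ?W" using e by (simp add: norm_mult)
      show "?V * ?W \<le> Re (cnj X * Y)"
        using cmod_add_power2[of X Y] unfolding s e by (simp add: power2_sum)
    qed
    moreover have "cnj \<mu> * \<mu> = 1" using \<mu>(1) complex_norm_square[of \<mu>] by (simp add: mult.commute)
    then have "cnj \<mu> * (cnj X * Y) = cnj X * \<phi> (a * y)"
      unfolding Y_def by (metis mult.left_commute mult.assoc mult_1)
    ultimately have "cnj (\<phi> (a * x)) * \<phi> (a * y) = cnj \<mu> * of_real ?V * of_real ?W"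
      by (simp add: X_def mult.assoc)
    then show ?R using \<phi>(1) \<mu>(1) by blast
  next
    assume ?R
    then obtain \<phi> \<mu> where \<phi>: "\<phi> \<in> a_states a" and \<mu>: "cmod \<mu> = 1"
      and eq: "cnj (\<phi> (a * x)) * \<phi> (a * y) = cnj \<mu> * of_real ?V * of_real ?W"
      by blast
    obtain \<phi>1 where \<phi>1: "\<phi>1 \<in> a_states a" "cmod (\<phi>1 (a * x)) = ?V" using att by blast
    obtain \<phi>2 where \<phi>2: "\<phi>2 \<in> a_states a" "cmod (\<phi>2 (a * y)) = ?W" using att by blast
    have V: "0 \<le> ?V" and W: "0 \<le> ?W" using \<phi>1(2) \<phi>2(2) norm_ge_zero by metis+
    have "\<exists>\<psi>\<in>a_states a. cmod (\<psi> (a * x) + \<mu> * \<psi> (a * y)) = ?V + ?W"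
    \<comment> \<open>If one radius vanishes, the equation says nothing about \<open>\<phi>\<close>; a state attaining the other radius works.\<close>
    proof (cases "?V = 0 \<or> ?W = 0")
      case True
      then show ?thesis
      proof
        assume V: "?V = 0"
        then have "\<phi>2 (a * x) = 0" using le[OF \<phi>2(1), of x] by simp
        then show ?thesis using \<phi>2 \<mu> V by (intro bexI[of _ \<phi>2]) (auto simp: norm_mult)
      next
        assume W: "?W = 0"
        then have "\<phi>1 (a * y) = 0" using le[OF \<phi>1(1), of y] by simp
        then show ?thesis using \<phi>1 W by (intro bexI[of _ \<phi>1]) auto
      qed
    next
      case False
      then have pos: "0 < ?V" "0 < ?W" using V W by auto
      define X Y where "X = \<phi> (a * x)" and "Y = \<mu> * \<phi> (a * y)"
      have n: "cmod X \<le> ?V" "cmod Y \<le> ?W" using le[OF \<phi>] \<mu> by (auto simp: X_def Y_def norm_mult)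
      have "\<mu> * cnj \<mu> = 1" using \<mu> complex_norm_square[of \<mu>] by simp
      then have XY: "cnj X * Y = of_real (?V * ?W)"
        using eq unfolding X_def Y_def by (metis mult.assoc mult.left_commute mult_1 of_real_mult)
      have p: "cmod X * cmod Y = ?V * ?W"
        using arg_cong[OF XY, of cmod] pos by (simp add: norm_mult)
      have "?V * cmod Y \<ge> ?V * ?W" using mult_right_mono[OF n(1), of "cmod Y"] p by simp
      then have "cmod Y = ?W" using n pos by simp
      moreover have "cmod X * ?W \<ge> ?V * ?W" using mult_left_mono[OF n(2), of "cmod X"] p by simp
      then have "cmod X = ?V" using n pos by simp
      ultimately have "(cmod (X + Y))\<^sup>2 = (?V + ?W)\<^sup>2"
        unfolding cmod_add_power2 XY by (simp add: power2_sum)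
      then have "cmod (X + Y) = ?V + ?W" using V W by (simp add: power2_eq_iff_nonneg)
      then show ?thesis using \<phi> by (auto simp: X_def Y_def)
    qed
    then obtain \<psi> where \<psi>: "\<psi> \<in> a_states a" "cmod (\<psi> (a * (x + \<mu> *\<^sub>C y))) = ?V + ?W"
      using add by auto
    obtain \<rho> where \<rho>: "\<rho> \<in> a_states a"
      "cmod (\<rho> (a * (x + \<mu> *\<^sub>C y))) = a_numerical_radius a (x + \<mu> *\<^sub>C y)" using att by blast
    have "cmod (\<rho> (a * (x + \<mu> *\<^sub>C y))) \<le> cmod (\<rho> (a * x)) + cmod (\<rho> (a * y))"
      unfolding add[OF \<rho>(1)] using norm_triangle_ineq[of "\<rho> (a * x)" "\<mu> * \<rho> (a * y)"] \<mu>
      by (simp add: norm_mult)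
    then have "a_numerical_radius a (x + \<mu> *\<^sub>C y) \<le> ?V + ?W"
      using le[OF \<rho>(1), of x] le[OF \<rho>(1), of y] \<rho>(2) by linarith
    moreover have "?V + ?W \<le> a_numerical_radius a (x + \<mu> *\<^sub>C y)"
      using le[OF \<psi>(1), of "x + \<mu> *\<^sub>C y"] \<psi>(2) by simp
    ultimately show "a_numerical_radius_parallel a x y"
      using \<mu> unfolding a_numerical_radius_parallel_def by (intro exI[of _ \<mu>]) simp
  }
qed

lemma a_norm_parallel_iff:
  fixes a x y :: "'a::unital_cstar_algebra"
  assumes a: "positive_elem a" "invertible_elem a"
  shows "a_norm_parallel a x y \<longleftrightarrow>
           (\<exists>\<phi>\<in>a_states a. \<exists>\<mu>. cmod \<mu> = 1 \<and>
              \<phi> (star x * a * x) = of_real ((a_norm a x)\<^sup>2) \<and>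
              \<phi> (star y * a * y) = of_real ((a_norm a y)\<^sup>2) \<and>
              \<phi> (star x * a * y) = cnj \<mu> * of_real (a_norm a x) * of_real (a_norm a y))"
    (is "_ \<longleftrightarrow> ?R")
proof
  let ?N = "a_norm a x" and ?M = "a_norm a y"
  note le = a_norm_attained(1)[OF a] and att = a_norm_attained(2)[OF a]
  note N = a_norm_nonneg[OF a, of x] and M = a_norm_nonneg[OF a, of y]
  define A where "A \<phi> = Re (\<phi> (star x * a * x))" for \<phi> :: "'a \<Rightarrow> complex"
  define D where "D \<phi> = Re (\<phi> (star y * a * y))" for \<phi> :: "'a \<Rightarrow> complex"
  have form: "Re (\<phi> (star (x + \<mu> *\<^sub>C y) * a * (x + \<mu> *\<^sub>C y)))
      = A \<phi> + D \<phi> + 2 * Re (\<mu> * \<phi> (star x * a * y))"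
    and nonneg: "0 \<le> A \<phi>" "0 \<le> D \<phi>"
      "0 \<le> Re (\<phi> (star (x + \<mu> *\<^sub>C y) * a * (x + \<mu> *\<^sub>C y)))"
    and real: "\<phi> (star x * a * x) = of_real (A \<phi>)" "\<phi> (star y * a * y) = of_real (D \<phi>)"
    and CS: "cmod (\<mu> * \<phi> (star x * a * y)) \<le> sqrt (A \<phi>) * sqrt (D \<phi>)"
    and bound: "sqrt (A \<phi>) \<le> ?N" "sqrt (D \<phi>) \<le> ?M"
    if "\<phi> \<in> a_states a" "cmod \<mu> = 1" for \<phi> \<mu>
  proof -
    interpret positive_dual \<phi> by (rule positive_dual_a_states[OF that(1)])
    show "Re (\<phi> (star (x + \<mu> *\<^sub>C y) * a * (x + \<mu> *\<^sub>C y)))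
      = A \<phi> + D \<phi> + 2 * Re (\<mu> * \<phi> (star x * a * y))"
      unfolding sesquilinear_form_add[OF positive_elem_star[OF a(1)]] using that(2) by (simp add: A_def D_def)
    show "0 \<le> A \<phi>" "0 \<le> D \<phi>" "0 \<le> Re (\<phi> (star (x + \<mu> *\<^sub>C y) * a * (x + \<mu> *\<^sub>C y)))"
      using nonneg[OF positive_elem_conjugate[OF a]] by (auto simp: A_def D_def)
    show "\<phi> (star x * a * x) = of_real (A \<phi>)" "\<phi> (star y * a * y) = of_real (D \<phi>)"
      using nonneg[OF positive_elem_conjugate[OF a]] by (auto simp: A_def D_def complex_eq_iff)
    show "cmod (\<mu> * \<phi> (star x * a * y)) \<le> sqrt (A \<phi>) * sqrt (D \<phi>)"
      using Cauchy_Schwarz[OF a, of x y] that(2) by (simp add: A_def D_def norm_mult)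
    show "sqrt (A \<phi>) \<le> ?N" "sqrt (D \<phi>) \<le> ?M" using le[OF that(1)] by (simp_all add: A_def D_def)
  qed
  have sq: "A \<phi> = sqrt (A \<phi>) * sqrt (A \<phi>)" "D \<phi> = sqrt (D \<phi>) * sqrt (D \<phi>)"
    if "\<phi> \<in> a_states a" for \<phi>
    using nonneg(1,2)[OF that, of 1] by simp_all
  {
    assume "a_norm_parallel a x y"
    then obtain \<mu> where \<mu>: "cmod \<mu> = 1" "a_norm a (x + \<mu> *\<^sub>C y) = ?N + ?M"
      by (auto simp: a_norm_parallel_def)
    obtain \<phi> where \<phi>: "\<phi> \<in> a_states a"
      "sqrt (Re (\<phi> (star (x + \<mu> *\<^sub>C y) * a * (x + \<mu> *\<^sub>C y)))) = ?N + ?M"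
      using att[of "x + \<mu> *\<^sub>C y"] \<mu>(2) by auto
    note f = form[OF \<phi>(1) \<mu>(1)] nonneg[OF \<phi>(1) \<mu>(1)] CS[OF \<phi>(1) \<mu>(1)] bound[OF \<phi>(1) \<mu>(1)]
    let ?\<beta> = "\<mu> * \<phi> (star x * a * y)"
    have "(?N + ?M)\<^sup>2 = A \<phi> + D \<phi> + 2 * Re ?\<beta>"
      using \<phi>(2) f(4) unfolding f(1) by (metis real_sqrt_pow2)
    moreover have Re: "Re ?\<beta> \<le> sqrt (A \<phi>) * sqrt (D \<phi>)"
      using f(5) complex_Re_le_cmod[of ?\<beta>] by linarith
    moreover have "(sqrt (A \<phi>) + sqrt (D \<phi>))\<^sup>2 = A \<phi> + D \<phi> + 2 * (sqrt (A \<phi>) * sqrt (D \<phi>))"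
      using f(2,3) by (simp add: power2_sum)
    ultimately have "(?N + ?M)\<^sup>2 \<le> (sqrt (A \<phi>) + sqrt (D \<phi>))\<^sup>2" by linarith
    then have "?N + ?M \<le> sqrt (A \<phi>) + sqrt (D \<phi>)" by (rule power2_le_imp_le) (simp add: f(2,3))
    then have e: "sqrt (A \<phi>) = ?N" "sqrt (D \<phi>) = ?M" using f(6,7) by linarith+
    have AD: "A \<phi> = ?N\<^sup>2" "D \<phi> = ?M\<^sup>2" using f(2,3) e by (metis real_sqrt_pow2)+
    have "?\<beta> = of_real (?N * ?M)"
    proof (rule complex_eq_of_realI)
      show "cmod ?\<beta> \<le> ?N * ?M" using f(5) unfolding e .
      show "?N * ?M \<le> Re ?\<beta>"
        using \<open>(?N + ?M)\<^sup>2 = A \<phi> + D \<phi> + 2 * Re ?\<beta>\<close> unfolding AD power2_sum by simp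
    qed
    moreover have "cnj \<mu> * \<mu> = 1" using \<mu>(1) complex_norm_square[of \<mu>] by (simp add: mult.commute)
    ultimately have "\<phi> (star x * a * y) = cnj \<mu> * of_real ?N * of_real ?M"
      by (metis mult.assoc mult_1 of_real_mult)
    then show ?R using \<phi>(1) \<mu>(1) real[OF \<phi>(1) \<mu>(1)] AD by metis
  next
    assume ?R
    then obtain \<phi> \<mu> where \<phi>: "\<phi> \<in> a_states a" and \<mu>: "cmod \<mu> = 1"
      and eq: "\<phi> (star x * a * x) = of_real (?N\<^sup>2)" "\<phi> (star y * a * y) = of_real (?M\<^sup>2)"
        "\<phi> (star x * a * y) = cnj \<mu> * of_real ?N * of_real ?M"
      by blast
    have "\<mu> * cnj \<mu> = 1" using \<mu> complex_norm_square[of \<mu>] by simp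
    then have "\<mu> * \<phi> (star x * a * y) = of_real (?N * ?M)"
      unfolding eq(3) by (simp add: mult.assoc[symmetric])
    then have "Re (\<phi> (star (x + \<mu> *\<^sub>C y) * a * (x + \<mu> *\<^sub>C y))) = (?N + ?M)\<^sup>2"
      unfolding form[OF \<phi> \<mu>] by (simp add: A_def D_def eq(1,2) power2_sum)
    then have ge: "?N + ?M \<le> a_norm a (x + \<mu> *\<^sub>C y)"
      using le[OF \<phi>, of "x + \<mu> *\<^sub>C y"] N M by simp
    obtain \<rho> where \<rho>: "\<rho> \<in> a_states a"
      "sqrt (Re (\<rho> (star (x + \<mu> *\<^sub>C y) * a * (x + \<mu> *\<^sub>C y)))) = a_norm a (x + \<mu> *\<^sub>C y)"
      using att by blast
    note f = form[OF \<rho>(1) \<mu>] nonneg[OF \<rho>(1) \<mu>] CS[OF \<rho>(1) \<mu>] bound[OF \<rho>(1) \<mu>]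
    have "(sqrt (A \<rho>) + sqrt (D \<rho>))\<^sup>2 = A \<rho> + D \<rho> + 2 * (sqrt (A \<rho>) * sqrt (D \<rho>))"
      using f(2,3) by (simp add: power2_sum)
    then have "Re (\<rho> (star (x + \<mu> *\<^sub>C y) * a * (x + \<mu> *\<^sub>C y))) \<le> (sqrt (A \<rho>) + sqrt (D \<rho>))\<^sup>2"
      using f(1,5) complex_Re_le_cmod[of "\<mu> * \<rho> (star x * a * y)"] by linarith
    then have "a_norm a (x + \<mu> *\<^sub>C y) \<le> sqrt (A \<rho>) + sqrt (D \<rho>)"
      unfolding \<rho>(2)[symmetric] by (intro real_le_lsqrt) (simp_all add: f(2,3))
    then have "a_norm a (x + \<mu> *\<^sub>C y) \<le> ?N + ?M" using f(6,7) by linarith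
    then show "a_norm_parallel a x y"
      using ge \<mu> unfolding a_norm_parallel_def by (intro exI[of _ \<mu>]) simp
  }
qed

theorem corollary3p5:
  fixes a x y :: "'a::unital_cstar_algebra"
  assumes "positive_elem a" and "invertible_elem a"
  shows "(a_numerical_radius_parallel a x y \<longleftrightarrow>
           (\<exists>\<phi>\<in>a_states a. \<exists>\<mu>. cmod \<mu> = 1 \<and>
              cnj (\<phi> (a * x)) * \<phi> (a * y) =
                cnj \<mu> * of_real (a_numerical_radius a x) * of_real (a_numerical_radius a y)))
       \<and> (a_norm_parallel a x y \<longleftrightarrow>
           (\<exists>\<phi>\<in>a_states a. \<exists>\<mu>. cmod \<mu> = 1 \<and>
              \<phi> (star x * a * x) = of_real ((a_norm a x)\<^sup>2) \<and>
              \<phi> (star y * a * y) = of_real ((a_norm a y)\<^sup>2) \<and>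
              \<phi> (star x * a * y) = cnj \<mu> * of_real (a_norm a x) * of_real (a_norm a y)))"
  using a_numerical_radius_parallel_iff[OF assms] a_norm_parallel_iff[OF assms] by (rule conjI)

end
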